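(* Let $(M,L,\psi)$ be a weighted Finsler spacetime of dimension $n+1$, let $\mathsf{J}$ be a Jacobi tensor field along a timelike geodesic $\eta:I\to M$ of unit speed, and let $\epsilon\in\mathbb{R}$. At every $t\in I$ where $\mathsf{J}(t)$ is invertible, $\mathsf{B}_\epsilon:=\mathsf{J}_\psi^*\mathsf{J}_\psi^{-1}$ satisfies $$\mathsf{B}_\epsilon^*+\frac{2\epsilon}{n}\psi_\eta^*\,\mathsf{B}_\epsilon+\mathsf{B}_\epsilon^2+\mathsf{R}_{(0,\epsilon)}=0.$$
   Context: **Lorentz–Finsler setting.** $M$ is a connected $C^\infty$-manifold without boundary of dimension $n+1\ge2$. A Lorentz–Finsler structure is a function $L:TM\to\mathbb{R}$ such that $L\in C^\infty(TM\setminus\{0\})$; $L(cv)=c^2L(v)$ for all $v\in TM$, $c>0$; and for every $v\in TM\setminus\{0\}$ the matrix $g_{\alpha\beta}(v)=\frac{\partial^2 L}{\partial v^\alpha\partial v^\beta}(v)$, $\alpha,\beta=0,\dots,n$, is non-degenerate of signature $(-,+,\dots,+)$. It defines a Lorentzian inner product $g_v$ on $T_xM$ (for $v\in T_xM\setminus\{0\}$), with $g_v(v,v)=2L(v)$. A vector $v$ is timelike if $L(v)<0$, lightlike if $L(v)=0$ and $v\ne 0$, causal if timelike or lightlike. A Finsler spacetime is such an $(M,L)$ time-oriented by a smooth vector field $X$ with $L(X(x))<0$ for all $x$. A causal $v\in T_xM$ is future-directed if it lies in the same connected component of $\overline{\Omega'_x}\setminus\{0\}$ as $X(x)$, where $\Omega'_x=\{v\in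 T_xM: L(v)<0\}$. $\Omega_x$ is the set of future-directed timelike vectors, $\overline\Omega=\bigcup_x\overline\Omega_x$. $F(v)=\sqrt{-2L(v)}$ on causal vectors; a timelike geodesic has unit speed if $F(\dot\eta)\equiv1$. All causal curves and geodesics are future-directed. **Connection and curvature.** With $(g^{\alpha\beta}(v))$ the inverse matrix, set $\widetilde\Gamma^\alpha_{\beta\gamma}(v)=\frac12\sum_\delta g^{\alpha\delta}(v)\big(\frac{\partial g_{\delta\gamma}}{\partial x^\beta}+\frac{\partial g_{\beta\delta}}{\partial x^\gamma}-\frac{\partial g_{\beta\gamma}}{\partial x^\delta}\big)(v)$, $G^\alpha(v)=\frac12\sum_{\beta,\gamma}\widetilde\Gamma^\alpha_{\beta\gamma}(v)v^\beta v^\gamma$, $N^\alpha_\beta(v)=\frac{\partial G^\alpha}{\partial v^\beta}(v)$, and $\Gamma^\alpha_{\beta\gamma}(v)=\widetilde\Gamma^\alpha_{\beta\gamma}(v)-\frac12\sum_{\delta,\mu}g^{\alpha\delta}(v)\big(\frac{\partial g_{\delta\gamma}}{\partial v^\mu}N^\mu_\beta+\frac{\partial g_{\beta\delta}}{\partial v^\mu}N^\mu_\gamma-\frac{\partial g_{\beta\gamma}}{\partial v^\mu}N^\mu_\delta\big)(v)$. Along a curve $\eta$, the covariant derivative $Y'=D^{\dot\eta}_{\dot\eta}Y$ has components $\dot Y^\alpha+\sum\Gamma^\alpha_{\beta\gamma}(\dot\eta)\dot\eta^\beta Y^\gamma$; for endomorphism fields $E$, $E'(P)=E(P)'-E(P')$.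 A causal geodesic is a smooth causal curve with $\ddot\eta^\alpha+2G^\alpha(\dot\eta)=0$. Put $R^\alpha_\beta(v)=2\frac{\partial G^\alpha}{\partial x^\beta}-\sum_\gamma\big(\frac{\partial N^\alpha_\beta}{\partial x^\gamma}v^\gamma-2\frac{\partial N^\alpha_\beta}{\partial v^\gamma}G^\gamma\big)-\sum_\gamma N^\alpha_\gamma N^\gamma_\beta$ (all at $v$), and $R_v(w)=\sum R^\alpha_\beta(v)w^\beta\frac{\partial}{\partial x^\alpha}$. **Weight.** $\psi:\overline\Omega\setminus\{0\}\to\mathbb{R}$ is $C^\infty$ with $\psi(cv)=\psi(v)$ for $c>0$; $\psi_\eta(t)=\psi(\dot\eta(t))$. **Jacobi tensors, $\epsilon$-proper time.** Let $\eta:I\to M$ be a unit-speed timelike geodesic, $N_\eta(t)\subset T_{\eta(t)}M$ the $n$-dimensional $g_{\dot\eta(t)}$-orthogonal complement of $\dot\eta(t)$, $\mathsf{R}(t)=R_{\dot\eta(t)}:N_\eta(t)\to N_\eta(t)$, and $I_n$ the identity of $N_\eta(t)$. A Jacobi tensor field is a smooth field of endomorphisms $\mathsf{J}(t)$ of $N_\eta(t)$ with $\mathsf{J}''+\mathsf{R}\mathsf{J}=0$ and $\ker\mathsf{J}(t)\cap\ker\mathsf{J}'(t)=\{0\}$ for all $t\in I$. $\mathsf{J}_\psi(t)=e^{-\psi_\eta(t)/n}\mathsf{J}(t)$. The $\epsilon$-proper time is $\tau_\epsilon=\int e^{\frac{2(\epsilon-1)}{n}\psi_\eta(t)}dt$,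 and $*$ denotes the (covariant) derivative with respect to $\tau_\epsilon$, i.e. $(\cdot)^*=e^{\frac{2(1-\epsilon)}{n}\psi_\eta}(\cdot)'$. The weighted curvature endomorphism is, for $N\ne n$, $\mathsf{R}_{(N,\epsilon)}(t)=e^{\frac{4(1-\epsilon)}{n}\psi_\eta(t)}\big\{\mathsf{R}(t)+\frac1n\big(\psi_\eta''(t)-\frac{\psi_\eta'(t)^2}{N-n}\big)I_n\big\}$; here it is used with $N=0$. *)

theory Defs
  imports "HOL-Analysis.Analysis" "HOL-Library.Function_Algebras"
begin

section \<open>Smoothness\<close>

text \<open>For open \<open>S\<close>: all partial derivatives up to order \<open>k\<close> exist and are continuous.\<close>

primrec Ck_on :: "nat \<Rightarrow> 'a::euclidean_space set \<Rightarrow> ('a \<Rightarrow> 'b::real_normed_vector) \<Rightarrow> bool" where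
  "Ck_on 0 S f \<longleftrightarrow> continuous_on S f"
| "Ck_on (Suc k) S f \<longleftrightarrow>
     (\<forall>x\<in>S. f differentiable (at x)) \<and> (\<forall>v. Ck_on k S (\<lambda>x. frechet_derivative f (at x) v))"

definition smooth_on :: "'a::euclidean_space set \<Rightarrow> ('a \<Rightarrow> 'b::real_normed_vector) \<Rightarrow> bool" where
  "smooth_on S f \<longleftrightarrow> (\<forall>k. Ck_on k S f)"

text \<open>Smoothness on an arbitrary set: locally the restriction of a smooth function on an open set.\<close>

definition smooth_on_arbitrary :: "'a::euclidean_space set \<Rightarrow> ('a \<Rightarrow> 'b::real_normed_vector) \<Rightarrow> bool" where
  "smooth_on_arbitrary D f \<longleftrightarrow>
     (\<forall>z\<in>D. \<exists>W h. open W \<and> z \<in> W \<and> smooth_on W h \<and> (\<forall>y\<in>W \<inter> D. h y = f y))"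

text \<open>Functions of one real variable on (relatively open subsets of) an interval that need not be
  open; derivatives at end points are one-sided.\<close>

primrec Ck_curve_on :: "nat \<Rightarrow> real set \<Rightarrow> (real \<Rightarrow> 'b::real_normed_vector) \<Rightarrow> bool" where
  "Ck_curve_on 0 S f \<longleftrightarrow> continuous_on S f"
| "Ck_curve_on (Suc k) S f \<longleftrightarrow>
     (\<exists>f'. (\<forall>t\<in>S. (f has_vector_derivative f' t) (at t within S)) \<and> Ck_curve_on k S f')"

definition smooth_curve_on :: "real set \<Rightarrow> (real \<Rightarrow> 'b::real_normed_vector) \<Rightarrow> bool" where
  "smooth_curve_on S f \<longleftrightarrow> (\<forall>k. Ck_curve_on k S f)"

section \<open>Manifolds and tangent vectors\<close>

text \<open>A chart is a pair of its domain and its coordinate map; the manifold is the whole type \<open>'m\<close>.\<close>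

type_synonym ('m, 'i) chart = "'m set \<times> ('m \<Rightarrow> real ^ 'i)"

definition chart_inv :: "('m, 'i) chart \<Rightarrow> real ^ 'i \<Rightarrow> 'm" where
  "chart_inv c = inv_into (fst c) (snd c)"

definition transition :: "('m, 'i) chart \<Rightarrow> ('m, 'i) chart \<Rightarrow> real ^ 'i \<Rightarrow> real ^ 'i" where
  "transition c d = snd d \<circ> chart_inv c"

definition smooth_atlas ::
  "('m::{t2_space, second_countable_topology}, 'i::finite) chart set \<Rightarrow> bool" where
  "smooth_atlas A \<longleftrightarrow>
     (\<Union>c\<in>A. fst c) = UNIV \<and>
     (\<forall>c\<in>A. open (fst c) \<and> open (snd c ` fst c) \<and>
        homeomorphism (fst c) (snd c ` fst c) (snd c) (chart_inv c)) \<and>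
     (\<forall>c\<in>A. \<forall>d\<in>A. smooth_on (snd c ` (fst c \<inter> fst d)) (transition c d))"

text \<open>A tangent vector at \<open>x\<close> is the family of its components \<open>v c\<close> in all charts \<open>c\<close> around \<open>x\<close>,
  which transform by the derivatives of the coordinate changes; the components in all other
  charts are set to 0. Addition and zero of tangent vectors are the pointwise ones.\<close>

type_synonym ('m, 'i) tvec = "('m, 'i) chart \<Rightarrow> real ^ 'i"

definition tangent_space :: "('m, 'i::finite) chart set \<Rightarrow> 'm \<Rightarrow> ('m, 'i) tvec set" where
  "tangent_space A x =
     {v. (\<forall>c\<in>A. \<forall>d\<in>A. x \<in> fst c \<inter> fst d \<longrightarrow>
            v d = frechet_derivative (transition c d) (at (snd c x)) (v c)) \<and>
         (\<forall>c. \<not> (c \<in> A \<and> x \<in> fst c) \<longrightarrow> v c = 0)}"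

definition tscale :: "real \<Rightarrow> ('m, 'i::finite) tvec \<Rightarrow> ('m, 'i) tvec" where
  "tscale a v = (\<lambda>c. a *\<^sub>R v c)"

text \<open>The tangent vector at \<open>x\<close> with components \<open>w\<close> in the chart \<open>c\<close>.\<close>

definition tvec_of :: "('m, 'i::finite) chart set \<Rightarrow> ('m, 'i) chart \<Rightarrow> 'm \<Rightarrow> real ^ 'i \<Rightarrow> ('m, 'i) tvec" where
  "tvec_of A c x w =
     (\<lambda>d. if d \<in> A \<and> x \<in> fst d then frechet_derivative (transition c d) (at (snd c x)) w else 0)"

text \<open>A function on (a subset of) the tangent bundle is written in curried form \<open>f x v\<close>, where
  \<open>v\<close> is in the tangent space at \<open>x\<close>. Its coordinate expression in the chart \<open>c\<close> is a function of
  the pair (base coordinates, fibre coordinates).\<close>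

definition in_chart ::
  "('m, 'i::finite) chart set \<Rightarrow> ('m, 'i) chart \<Rightarrow> ('m \<Rightarrow> ('m, 'i) tvec \<Rightarrow> real) \<Rightarrow>
   (real ^ 'i) \<times> (real ^ 'i) \<Rightarrow> real" where
  "in_chart A c f = (\<lambda>(p, w). f (chart_inv c p) (tvec_of A c (chart_inv c p) w))"

section \<open>The coordinate expressions of metric, connection and curvature\<close>

text \<open>Here \<open>l\<close> is the coordinate expression of \<open>L\<close>, and \<open>z = (x, v)\<close>; \<open>dx\<close> and \<open>dv\<close> are the
  partial derivatives in the base and in the fibre coordinates.\<close>

definition dx :: "'i::finite \<Rightarrow> ((real ^ 'i) \<times> (real ^ 'i) \<Rightarrow> real) \<Rightarrow> (real ^ 'i) \<times> (real ^ 'i) \<Rightarrow> real" where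
  "dx i f z = frechet_derivative f (at z) (axis i 1, 0)"

definition dv :: "'i::finite \<Rightarrow> ((real ^ 'i) \<times> (real ^ 'i) \<Rightarrow> real) \<Rightarrow> (real ^ 'i) \<times> (real ^ 'i) \<Rightarrow> real" where
  "dv i f z = frechet_derivative f (at z) (0, axis i 1)"

context
  fixes l :: "(real ^ 'i::finite) \<times> (real ^ 'i) \<Rightarrow> real"
begin

definition met :: "'i \<Rightarrow> 'i \<Rightarrow> (real ^ 'i) \<times> (real ^ 'i) \<Rightarrow> real" where
  "met \<alpha> \<beta> = dv \<alpha> (dv \<beta> l)"

definition met_matrix :: "(real ^ 'i) \<times> (real ^ 'i) \<Rightarrow> real ^ 'i ^ 'i" where
  "met_matrix z = (\<chi> \<alpha> \<beta>. met \<alpha> \<beta> z)"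

definition met_form :: "(real ^ 'i) \<times> (real ^ 'i) \<Rightarrow> real ^ 'i \<Rightarrow> real ^ 'i \<Rightarrow> real" where
  "met_form z u w = (\<Sum>\<alpha>\<in>UNIV. \<Sum>\<beta>\<in>UNIV. met \<alpha> \<beta> z * u $ \<alpha> * w $ \<beta>)"

definition met_inv :: "'i \<Rightarrow> 'i \<Rightarrow> (real ^ 'i) \<times> (real ^ 'i) \<Rightarrow> real" where
  "met_inv \<alpha> \<beta> z = matrix_inv (met_matrix z) $ \<alpha> $ \<beta>"

definition Gamma_tilde :: "'i \<Rightarrow> 'i \<Rightarrow> 'i \<Rightarrow> (real ^ 'i) \<times> (real ^ 'i) \<Rightarrow> real" where
  "Gamma_tilde \<alpha> \<beta> \<gamma> z = 1 / 2 * (\<Sum>\<delta>\<in>UNIV. met_inv \<alpha> \<delta> z *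
     (dx \<beta> (met \<delta> \<gamma>) z + dx \<gamma> (met \<beta> \<delta>) z - dx \<delta> (met \<beta> \<gamma>) z))"

definition spray :: "'i \<Rightarrow> (real ^ 'i) \<times> (real ^ 'i) \<Rightarrow> real" where
  "spray \<alpha> z = 1 / 2 * (\<Sum>\<beta>\<in>UNIV. \<Sum>\<gamma>\<in>UNIV. Gamma_tilde \<alpha> \<beta> \<gamma> z * snd z $ \<beta> * snd z $ \<gamma>)"

definition nonlin :: "'i \<Rightarrow> 'i \<Rightarrow> (real ^ 'i) \<times> (real ^ 'i) \<Rightarrow> real" where
  "nonlin \<alpha> \<beta> = dv \<beta> (spray \<alpha>)"

definition Gamma_chern :: "'i \<Rightarrow> 'i \<Rightarrow> 'i \<Rightarrow> (real ^ 'i) \<times> (real ^ 'i) \<Rightarrow> real" where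
  "Gamma_chern \<alpha> \<beta> \<gamma> z = Gamma_tilde \<alpha> \<beta> \<gamma> z -
     1 / 2 * (\<Sum>\<delta>\<in>UNIV. \<Sum>\<mu>\<in>UNIV. met_inv \<alpha> \<delta> z *
       (dv \<mu> (met \<delta> \<gamma>) z * nonlin \<mu> \<beta> z + dv \<mu> (met \<beta> \<delta>) z * nonlin \<mu> \<gamma> z
        - dv \<mu> (met \<beta> \<gamma>) z * nonlin \<mu> \<delta> z))"

definition curv_coeff :: "'i \<Rightarrow> 'i \<Rightarrow> (real ^ 'i) \<times> (real ^ 'i) \<Rightarrow> real" where
  "curv_coeff \<alpha> \<beta> z = 2 * dx \<beta> (spray \<alpha>) z
     - (\<Sum>\<gamma>\<in>UNIV. dx \<gamma> (nonlin \<alpha> \<beta>) z * snd z $ \<gamma> - 2 * dv \<gamma> (nonlin \<alpha> \<beta>) z * spray \<gamma> z)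
     - (\<Sum>\<gamma>\<in>UNIV. nonlin \<alpha> \<gamma> z * nonlin \<gamma> \<beta> z)"

end

section \<open>Weighted Finsler spacetimes\<close>

definition lorentzian_signature :: "real ^ 'i ^ 'i::finite \<Rightarrow> bool" where
  "lorentzian_signature g \<longleftrightarrow>
     (\<exists>(k::'i) (P::real ^ 'i ^ 'i). invertible P \<and>
        transpose P ** g ** P = (\<chi> i j. if i \<noteq> j then 0 else if i = k then - 1 else 1))"

definition lorentz_finsler ::
  "('m::{t2_space, second_countable_topology}, 'i::finite) chart set \<Rightarrow>
   ('m \<Rightarrow> ('m, 'i) tvec \<Rightarrow> real) \<Rightarrow> bool" where
  "lorentz_finsler A L \<longleftrightarrow>
     (\<forall>c\<in>A. smooth_on (snd c ` fst c \<times> (UNIV - {0})) (in_chart A c L)) \<and>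
     (\<forall>x. \<forall>v\<in>tangent_space A x. \<forall>a>0. L x (tscale a v) = a\<^sup>2 * L x v) \<and>
     (\<forall>c\<in>A. \<forall>p\<in>snd c ` fst c. \<forall>w. w \<noteq> 0 \<longrightarrow>
        lorentzian_signature (met_matrix (in_chart A c L) (p, w)))"

definition timelike_vectors ::
  "('m, 'i::finite) chart set \<Rightarrow> ('m \<Rightarrow> ('m, 'i) tvec \<Rightarrow> real) \<Rightarrow> 'm \<Rightarrow> ('m, 'i) tvec set" where
  "timelike_vectors A L x = {v \<in> tangent_space A x. L x v < 0}"

text \<open>The product topology on \<open>tvec\<close> induces the usual topology on the tangent space at \<open>x\<close>, which
  is a closed subset; hence \<open>closure\<close> below is the closure in the tangent space.\<close>

definition future_timelike ::
  "('m, 'i::finite) chart set \<Rightarrow> ('m \<Rightarrow> ('m, 'i) tvec \<Rightarrow> real) \<Rightarrow> ('m \<Rightarrow> ('m, 'i) tvec) \<Rightarrow>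
   'm \<Rightarrow> ('m, 'i) tvec set" where
  "future_timelike A L X x =
     {v \<in> timelike_vectors A L x. connected_component (closure (timelike_vectors A L x) - {0}) (X x) v}"

definition finsler_spacetime ::
  "('m::{t2_space, second_countable_topology}, 'i::finite) chart set \<Rightarrow>
   ('m \<Rightarrow> ('m, 'i) tvec \<Rightarrow> real) \<Rightarrow> ('m \<Rightarrow> ('m, 'i) tvec) \<Rightarrow> bool" where
  "finsler_spacetime A L X \<longleftrightarrow>
     connected (UNIV :: 'm set) \<and> smooth_atlas A \<and> lorentz_finsler A L \<and>
     (\<forall>x. X x \<in> tangent_space A x) \<and>
     (\<forall>c\<in>A. smooth_on (snd c ` fst c) (\<lambda>p. X (chart_inv c p) c)) \<and>
     (\<forall>x. L x (X x) < 0)"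

definition weight_function ::
  "('m::{t2_space, second_countable_topology}, 'i::finite) chart set \<Rightarrow>
   ('m \<Rightarrow> ('m, 'i) tvec \<Rightarrow> real) \<Rightarrow> ('m \<Rightarrow> ('m, 'i) tvec) \<Rightarrow>
   ('m \<Rightarrow> ('m, 'i) tvec \<Rightarrow> real) \<Rightarrow> bool" where
  "weight_function A L X \<psi> \<longleftrightarrow>
     (\<forall>c\<in>A. smooth_on_arbitrary
        {(p, w). p \<in> snd c ` fst c \<and>
           tvec_of A c (chart_inv c p) w \<in> closure (future_timelike A L X (chart_inv c p)) - {0}}
        (in_chart A c \<psi>)) \<and>
     (\<forall>x. \<forall>v\<in>closure (future_timelike A L X x) - {0}. \<forall>a>0. \<psi> x (tscale a v) = \<psi> x v)"

definition weighted_finsler_spacetime ::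
  "('m::{t2_space, second_countable_topology}, 'i::finite) chart set \<Rightarrow>
   ('m \<Rightarrow> ('m, 'i) tvec \<Rightarrow> real) \<Rightarrow> ('m \<Rightarrow> ('m, 'i) tvec) \<Rightarrow>
   ('m \<Rightarrow> ('m, 'i) tvec \<Rightarrow> real) \<Rightarrow> bool" where
  "weighted_finsler_spacetime A L X \<psi> \<longleftrightarrow> finsler_spacetime A L X \<and> weight_function A L X \<psi>"

section \<open>Timelike geodesics\<close>

text \<open>Curves are defined on an interval \<open>I\<close> with more than one point; all derivatives are taken
  within \<open>I\<close>, so \<open>I\<close> need not be open.\<close>

definition velocity ::
  "('m, 'i::finite) chart set \<Rightarrow> (real \<Rightarrow> 'm) \<Rightarrow> real set \<Rightarrow> real \<Rightarrow> ('m, 'i) tvec" where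
  "velocity A \<eta> I t =
     (\<lambda>c. if c \<in> A \<and> \<eta> t \<in> fst c then vector_derivative (snd c \<circ> \<eta>) (at t within I) else 0)"

abbreviation velocity_at ::
  "('m, 'i::finite) chart set \<Rightarrow> (real \<Rightarrow> 'm) \<Rightarrow> real set \<Rightarrow> ('m, 'i) chart \<Rightarrow> real \<Rightarrow>
   (real ^ 'i) \<times> (real ^ 'i)" where
  "velocity_at A \<eta> I c t \<equiv> (snd c (\<eta> t), velocity A \<eta> I t c)"

definition smooth_manifold_curve ::
  "('m::topological_space, 'i::finite) chart set \<Rightarrow> (real \<Rightarrow> 'm) \<Rightarrow> real set \<Rightarrow> bool" where
  "smooth_manifold_curve A \<eta> I \<longleftrightarrow>
     continuous_on I \<eta> \<and> (\<forall>c\<in>A. smooth_curve_on {t \<in> I. \<eta> t \<in> fst c} (snd c \<circ> \<eta>))"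

definition unit_timelike_geodesic ::
  "('m::{t2_space, second_countable_topology}, 'i::finite) chart set \<Rightarrow>
   ('m \<Rightarrow> ('m, 'i) tvec \<Rightarrow> real) \<Rightarrow> ('m \<Rightarrow> ('m, 'i) tvec) \<Rightarrow> (real \<Rightarrow> 'm) \<Rightarrow> real set \<Rightarrow> bool" where
  "unit_timelike_geodesic A L X \<eta> I \<longleftrightarrow>
     is_interval I \<and> (\<exists>a\<in>I. \<exists>b\<in>I. a < b) \<and>
     smooth_manifold_curve A \<eta> I \<and>
     (\<forall>t\<in>I. velocity A \<eta> I t \<in> future_timelike A L X (\<eta> t) \<and>
            sqrt (- 2 * L (\<eta> t) (velocity A \<eta> I t)) = 1) \<and>
     (\<forall>c\<in>A. \<forall>t\<in>I. \<eta> t \<in> fst c \<longrightarrow>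
        (\<forall>\<alpha>. vector_derivative (\<lambda>s. velocity A \<eta> I s c) (at t within I) $ \<alpha>
             + 2 * spray (in_chart A c L) \<alpha> (velocity_at A \<eta> I c t) = 0))"

section \<open>Tensor fields along a timelike geodesic\<close>

text \<open>The orthogonality is chart independent.\<close>

definition normal_complement ::
  "('m, 'i::finite) chart set \<Rightarrow> ('m \<Rightarrow> ('m, 'i) tvec \<Rightarrow> real) \<Rightarrow> (real \<Rightarrow> 'm) \<Rightarrow> real set \<Rightarrow>
   real \<Rightarrow> ('m, 'i) tvec set" where
  "normal_complement A L \<eta> I t =
     {w \<in> tangent_space A (\<eta> t). \<forall>c\<in>A. \<eta> t \<in> fst c \<longrightarrow>
        met_form (in_chart A c L) (velocity_at A \<eta> I c t) (velocity A \<eta> I t c) (w c) = 0}"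

text \<open>The covariant derivative of a vector field \<open>Y\<close> along \<open>\<eta>\<close> with reference vector the velocity
  of \<open>\<eta>\<close>, computed in the chart \<open>c\<close>. It does not depend on \<open>c\<close>; below every statement about it is
  made for all charts around \<open>\<eta> t\<close>.\<close>

definition cov_deriv ::
  "('m, 'i::finite) chart set \<Rightarrow> ('m \<Rightarrow> ('m, 'i) tvec \<Rightarrow> real) \<Rightarrow> (real \<Rightarrow> 'm) \<Rightarrow> real set \<Rightarrow>
   ('m, 'i) chart \<Rightarrow> (real \<Rightarrow> ('m, 'i) tvec) \<Rightarrow> real \<Rightarrow> ('m, 'i) tvec" where
  "cov_deriv A L \<eta> I c Y t = tvec_of A c (\<eta> t)
     (\<chi> \<alpha>. vector_derivative (\<lambda>s. Y s c) (at t within I) $ \<alpha> +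
        (\<Sum>\<beta>\<in>UNIV. \<Sum>\<gamma>\<in>UNIV. Gamma_chern (in_chart A c L) \<alpha> \<beta> \<gamma> (velocity_at A \<eta> I c t)
           * velocity A \<eta> I t c $ \<beta> * Y t c $ \<gamma>))"

definition smooth_normal_field ::
  "('m, 'i::finite) chart set \<Rightarrow> ('m \<Rightarrow> ('m, 'i) tvec \<Rightarrow> real) \<Rightarrow> (real \<Rightarrow> 'm) \<Rightarrow> real set \<Rightarrow>
   real set \<Rightarrow> (real \<Rightarrow> ('m, 'i) tvec) \<Rightarrow> bool" where
  "smooth_normal_field A L \<eta> I S P \<longleftrightarrow>
     (\<forall>s\<in>S. P s \<in> normal_complement A L \<eta> I s) \<and>
     (\<forall>c\<in>A. smooth_curve_on {s \<in> S. \<eta> s \<in> fst c} (\<lambda>s. P s c))"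

text \<open>An endomorphism of a space \<open>N\<close> of tangent vectors is represented by a function on all of
  \<open>tvec\<close>, of which only the values on \<open>N\<close> matter.\<close>

definition endomorphism :: "('m, 'i::finite) tvec set \<Rightarrow> (('m, 'i) tvec \<Rightarrow> ('m, 'i) tvec) \<Rightarrow> bool" where
  "endomorphism N E \<longleftrightarrow>
     (\<forall>w\<in>N. E w \<in> N) \<and> (\<forall>u\<in>N. \<forall>w\<in>N. E (u + w) = E u + E w) \<and>
     (\<forall>a. \<forall>w\<in>N. E (tscale a w) = tscale a (E w))"

definition smooth_endomorphism_field ::
  "('m, 'i::finite) chart set \<Rightarrow> ('m \<Rightarrow> ('m, 'i) tvec \<Rightarrow> real) \<Rightarrow> (real \<Rightarrow> 'm) \<Rightarrow> real set \<Rightarrow>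
   (real \<Rightarrow> ('m, 'i) tvec \<Rightarrow> ('m, 'i) tvec) \<Rightarrow> bool" where
  "smooth_endomorphism_field A L \<eta> I E \<longleftrightarrow>
     (\<forall>t\<in>I. endomorphism (normal_complement A L \<eta> I t) (E t)) \<and>
     (\<forall>S P. openin (top_of_set I) S \<and> smooth_normal_field A L \<eta> I S P \<longrightarrow>
        smooth_normal_field A L \<eta> I S (\<lambda>s. E s (P s)))"

text \<open>\<open>E' P = (E P)' - E (P')\<close> for all local smooth normal fields \<open>P\<close> near \<open>t\<close>.\<close>

definition has_endo_deriv ::
  "('m, 'i::finite) chart set \<Rightarrow> ('m \<Rightarrow> ('m, 'i) tvec \<Rightarrow> real) \<Rightarrow> (real \<Rightarrow> 'm) \<Rightarrow> real set \<Rightarrow>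
   (real \<Rightarrow> ('m, 'i) tvec \<Rightarrow> ('m, 'i) tvec) \<Rightarrow> (('m, 'i) tvec \<Rightarrow> ('m, 'i) tvec) \<Rightarrow> real \<Rightarrow> bool" where
  "has_endo_deriv A L \<eta> I E E' t \<longleftrightarrow>
     endomorphism (normal_complement A L \<eta> I t) E' \<and>
     (\<forall>S P. openin (top_of_set I) S \<and> t \<in> S \<and> smooth_normal_field A L \<eta> I S P \<longrightarrow>
        (\<forall>c\<in>A. \<eta> t \<in> fst c \<longrightarrow>
           (\<lambda>s. E s (P s) c) differentiable (at t within I) \<and>
           E' (P t) = cov_deriv A L \<eta> I c (\<lambda>s. E s (P s)) t - E t (cov_deriv A L \<eta> I c P t)))"

definition endo_differentiable ::
  "('m, 'i::finite) chart set \<Rightarrow> ('m \<Rightarrow> ('m, 'i) tvec \<Rightarrow> real) \<Rightarrow> (real \<Rightarrow> 'm) \<Rightarrow> real set \<Rightarrow>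
   (real \<Rightarrow> ('m, 'i) tvec \<Rightarrow> ('m, 'i) tvec) \<Rightarrow> real \<Rightarrow> bool" where
  "endo_differentiable A L \<eta> I E t \<longleftrightarrow> (\<exists>E'. has_endo_deriv A L \<eta> I E E' t)"

text \<open>Determined on the normal space at \<open>t\<close> whenever \<open>E\<close> is differentiable at \<open>t\<close>, since each
  normal vector extends to a local smooth normal field.\<close>

definition endo_deriv ::
  "('m, 'i::finite) chart set \<Rightarrow> ('m \<Rightarrow> ('m, 'i) tvec \<Rightarrow> real) \<Rightarrow> (real \<Rightarrow> 'm) \<Rightarrow> real set \<Rightarrow>
   (real \<Rightarrow> ('m, 'i) tvec \<Rightarrow> ('m, 'i) tvec) \<Rightarrow> real \<Rightarrow> ('m, 'i) tvec \<Rightarrow> ('m, 'i) tvec" where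
  "endo_deriv A L \<eta> I E t = (SOME E'. has_endo_deriv A L \<eta> I E E' t)"

text \<open>The curvature endomorphism at the velocity of \<open>\<eta>\<close>, computed in the chart \<open>c\<close>.\<close>

definition curvature ::
  "('m, 'i::finite) chart set \<Rightarrow> ('m \<Rightarrow> ('m, 'i) tvec \<Rightarrow> real) \<Rightarrow> (real \<Rightarrow> 'm) \<Rightarrow> real set \<Rightarrow>
   ('m, 'i) chart \<Rightarrow> real \<Rightarrow> ('m, 'i) tvec \<Rightarrow> ('m, 'i) tvec" where
  "curvature A L \<eta> I c t w = tvec_of A c (\<eta> t)
     (\<chi> \<alpha>. \<Sum>\<beta>\<in>UNIV. curv_coeff (in_chart A c L) \<alpha> \<beta> (velocity_at A \<eta> I c t) * w c $ \<beta>)"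

definition jacobi_tensor_field ::
  "('m, 'i::finite) chart set \<Rightarrow> ('m \<Rightarrow> ('m, 'i) tvec \<Rightarrow> real) \<Rightarrow> (real \<Rightarrow> 'm) \<Rightarrow> real set \<Rightarrow>
   (real \<Rightarrow> ('m, 'i) tvec \<Rightarrow> ('m, 'i) tvec) \<Rightarrow> bool" where
  "jacobi_tensor_field A L \<eta> I J \<longleftrightarrow>
     smooth_endomorphism_field A L \<eta> I J \<and>
     (\<exists>J' J''. \<forall>t\<in>I.
        has_endo_deriv A L \<eta> I J (J' t) t \<and> has_endo_deriv A L \<eta> I J' (J'' t) t \<and>
        (\<forall>c\<in>A. \<eta> t \<in> fst c \<longrightarrow>
           (\<forall>w\<in>normal_complement A L \<eta> I t. J'' t w + curvature A L \<eta> I c t (J t w) = 0)) \<and>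
        {w \<in> normal_complement A L \<eta> I t. J t w = 0} \<inter> {w \<in> normal_complement A L \<eta> I t. J' t w = 0} = {0})"

section \<open>Weights and \<open>\<epsilon>\<close>-proper time\<close>

definition weight_along ::
  "('m, 'i::finite) chart set \<Rightarrow> ('m \<Rightarrow> ('m, 'i) tvec \<Rightarrow> real) \<Rightarrow> (real \<Rightarrow> 'm) \<Rightarrow> real set \<Rightarrow>
   real \<Rightarrow> real" where
  "weight_along A \<psi> \<eta> I t = \<psi> (\<eta> t) (velocity A \<eta> I t)"

text \<open>In the following, \<open>f\<close> is the weight along the curve. The first two are the derivatives of a
  function \<open>h\<close> and of an endomorphism field \<open>E\<close> with respect to \<open>\<epsilon>\<close>-proper time.\<close>

definition star_fun :: "nat \<Rightarrow> real \<Rightarrow> (real \<Rightarrow> real) \<Rightarrow> real set \<Rightarrow> (real \<Rightarrow> real) \<Rightarrow> real \<Rightarrow> real" where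
  "star_fun n \<epsilon> f I h t = exp (2 * (1 - \<epsilon>) / n * f t) * vector_derivative h (at t within I)"

definition star_endo ::
  "('m, 'i::finite) chart set \<Rightarrow> ('m \<Rightarrow> ('m, 'i) tvec \<Rightarrow> real) \<Rightarrow> (real \<Rightarrow> 'm) \<Rightarrow> real set \<Rightarrow>
   nat \<Rightarrow> real \<Rightarrow> (real \<Rightarrow> real) \<Rightarrow>
   (real \<Rightarrow> ('m, 'i) tvec \<Rightarrow> ('m, 'i) tvec) \<Rightarrow> real \<Rightarrow> ('m, 'i) tvec \<Rightarrow> ('m, 'i) tvec" where
  "star_endo A L \<eta> I n \<epsilon> f E t w = tscale (exp (2 * (1 - \<epsilon>) / n * f t)) (endo_deriv A L \<eta> I E t w)"

definition weighted_jacobi ::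
  "nat \<Rightarrow> (real \<Rightarrow> real) \<Rightarrow> (real \<Rightarrow> ('m, 'i::finite) tvec \<Rightarrow> ('m, 'i) tvec) \<Rightarrow>
   real \<Rightarrow> ('m, 'i) tvec \<Rightarrow> ('m, 'i) tvec" where
  "weighted_jacobi n f J t w = tscale (exp (- f t / n)) (J t w)"

definition weighted_curvature ::
  "('m, 'i::finite) chart set \<Rightarrow> ('m \<Rightarrow> ('m, 'i) tvec \<Rightarrow> real) \<Rightarrow> (real \<Rightarrow> 'm) \<Rightarrow> real set \<Rightarrow>
   nat \<Rightarrow> real \<Rightarrow> real \<Rightarrow> (real \<Rightarrow> real) \<Rightarrow>
   ('m, 'i) chart \<Rightarrow> real \<Rightarrow> ('m, 'i) tvec \<Rightarrow> ('m, 'i) tvec" where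
  "weighted_curvature A L \<eta> I n N \<epsilon> f c t w =
     (let f' = (\<lambda>s. vector_derivative f (at s within I));
          f'' = (\<lambda>s. vector_derivative f' (at s within I))
      in tscale (exp (4 * (1 - \<epsilon>) / n * f t))
           (curvature A L \<eta> I c t w + tscale (1 / n * (f'' t - (f' t)\<^sup>2 / (N - n))) w))"

definition B_endo ::
  "('m, 'i::finite) chart set \<Rightarrow> ('m \<Rightarrow> ('m, 'i) tvec \<Rightarrow> real) \<Rightarrow> (real \<Rightarrow> 'm) \<Rightarrow> real set \<Rightarrow>
   nat \<Rightarrow> real \<Rightarrow> (real \<Rightarrow> real) \<Rightarrow>
   (real \<Rightarrow> ('m, 'i) tvec \<Rightarrow> ('m, 'i) tvec) \<Rightarrow> real \<Rightarrow> ('m, 'i) tvec \<Rightarrow> ('m, 'i) tvec" where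
  "B_endo A L \<eta> I n \<epsilon> f J t =
     star_endo A L \<eta> I n \<epsilon> f (weighted_jacobi n f J) t \<circ>
     inv_into (normal_complement A L \<eta> I t) (weighted_jacobi n f J t)"

end

theory Submission
  imports Defs
begin

text \<open>With \<open>U = J' J\<^sup>-\<^sup>1\<close> one has \<open>B = \<mu> (U - \<psi>' / n)\<close> for \<open>\<mu> = exp (2 (1 - \<epsilon>) \<psi> / n)\<close>, and the Jacobi
  equation gives \<open>U' = - R - U\<^sup>2\<close>; the claim is then an identity of coefficients. What has to be supplied
  is that \<open>J\<^sup>-\<^sup>1\<close> maps smooth normal fields to smooth normal fields near \<open>t\<close>, and that the covariant
  derivative of a normal field is normal, so that \<open>J\<close> may be cancelled in the product rule. The latter
  holds because Euler's relation kills every fibre derivative of the metric contracted with the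
  velocity, which reduces metric compatibility to the geodesic equation. The identities hold in every
  chart separately, so no transformation law of the connection or the curvature is needed; only the
  chart independence of orthogonality is.\<close>

section \<open>Smooth curves in normed spaces\<close>

text \<open>The coefficients match as follows; write p for \<psi>'. Differentiating \<mu> adds (2 (1
  - \<epsilon>) / n) \<mu> p B to the star derivative of B, and the term with 2 \<epsilon> / n
  completes this to (2 / n) \<mu> p B whatever \<epsilon> is. Its part linear in U cancels the cross
  term of B^2, and the squares leave (-2 + 1) / n^2 times (\<mu> p)^2. The weighted curvature
  returns exactly this amount because -1 / (N - n) = 1 / n for N = 0.

  Two features of the setting cause the work. An endomorphism field is differentiated only by
  testing it on smooth normal fields, so a product rule for J' J^-1 needs J^-1 to send test fields
  to test fields. Moreover J may be singular elsewhere on the interval, and the interval may contain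
  its end points; hence identities of fields hold only on relatively open neighbourhoods of t, and
  all derivatives are taken within the interval. Since \<open>L\<close> is smooth only off the zero
  section, every chart computation takes place on the slit bundle.\<close>

lemma Ck_curve_on_imp_continuous_on: "Ck_curve_on k S f \<Longrightarrow> continuous_on S f"
proof (cases k)
  case (Suc m)
  assume "Ck_curve_on k S f"
  with Suc obtain f' where "\<forall>t\<in>S. (f has_vector_derivative f' t) (at t within S)" by auto
  then show ?thesis
    unfolding continuous_on_eq_continuous_within using has_vector_derivative_continuous by blast
qed simp

text \<open>The recursion descends to the derivative, not to a lower order of the same curve, so the
  induction runs over all \<open>f\<close>; its base case is the continuity of a differentiable
  curve.\<close>

lemma Ck_curve_on_SucD: "Ck_curve_on (Suc k) S f \<Longrightarrow> Ck_curve_on k S f"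
proof (induction k arbitrary: f)
  case 0
  then show ?case using Ck_curve_on_imp_continuous_on[of "Suc 0" S f] by simp
next
  case (Suc k)
  then obtain f' where "\<forall>t\<in>S. (f has_vector_derivative f' t) (at t within S)" "Ck_curve_on (Suc k) S f'"
    by (metis Ck_curve_on.simps(2))
  with Suc.IH show ?case by auto
qed

lemma Ck_curve_on_subset: "Ck_curve_on k S f \<Longrightarrow> T \<subseteq> S \<Longrightarrow> Ck_curve_on k T f"
  by (induction k arbitrary: f)
    (auto intro: continuous_on_subset, meson has_vector_derivative_within_subset subsetD)

lemma Ck_curve_on_cong:
  assumes "Ck_curve_on k S f" "\<And>t. t \<in> S \<Longrightarrow> g t = f t"
  shows "Ck_curve_on k S g"
proof (cases k)
  case 0
  then show ?thesis using assms by (simp cong: continuous_on_cong)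
next
  case (Suc m)
  with assms obtain f' where "\<forall>t\<in>S. (f has_vector_derivative f' t) (at t within S)" "Ck_curve_on m S f'"
    by auto
  then show ?thesis unfolding Suc Ck_curve_on.simps
    using assms(2) by (blast intro: has_vector_derivative_transform)
qed

lemma Ck_curve_on_const: "Ck_curve_on k S (\<lambda>_. c)"
  by (induction k arbitrary: c) (auto intro!: exI[of _ "\<lambda>_. 0"] has_vector_derivative_const)

lemma Ck_curve_on_linear:
  "Ck_curve_on k S f \<Longrightarrow> bounded_linear h \<Longrightarrow> Ck_curve_on k S (\<lambda>t. h (f t))"
proof (induction k arbitrary: f)
  case 0
  then show ?case by (simp add: bounded_linear.continuous_on)
next
  case (Suc k)
  then obtain f' where "\<forall>t\<in>S. (f has_vector_derivative f' t) (at t within S)" "Ck_curve_on k S f'"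
    by auto
  then show ?case unfolding Ck_curve_on.simps
    using Suc by (intro exI[of _ "\<lambda>t. h (f' t)"]) (auto intro: bounded_linear.has_vector_derivative)
qed

lemma Ck_curve_on_add:
  "Ck_curve_on k S f \<Longrightarrow> Ck_curve_on k S g \<Longrightarrow> Ck_curve_on k S (\<lambda>t. f t + g t)"
proof (induction k arbitrary: f g)
  case 0
  then show ?case by (simp add: continuous_on_add)
next
  case (Suc k)
  from Suc.prems obtain f' g' where "\<forall>t\<in>S. (f has_vector_derivative f' t) (at t within S)" "Ck_curve_on k S f'"
    "\<forall>t\<in>S. (g has_vector_derivative g' t) (at t within S)" "Ck_curve_on k S g'"
    by auto
  then show ?case unfolding Ck_curve_on.simps
    using Suc.IH by (intro exI[of _ "\<lambda>t. f' t + g' t"]) (auto intro: has_vector_derivative_add)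
qed

lemma Ck_curve_on_bilinear:
  assumes h: "bounded_bilinear h"
  shows "Ck_curve_on k S f \<Longrightarrow> Ck_curve_on k S g \<Longrightarrow> Ck_curve_on k S (\<lambda>t. h (f t) (g t))"
proof (induction k arbitrary: f g)
  case 0
  then show ?case by (simp add: bounded_bilinear.continuous_on[OF h])
next
  case (Suc k)
  from Suc.prems obtain f' g' where 1: "\<forall>t\<in>S. (f has_vector_derivative f' t) (at t within S)" "Ck_curve_on k S f'"
    "\<forall>t\<in>S. (g has_vector_derivative g' t) (at t within S)" "Ck_curve_on k S g'"
    by auto
  moreover have "Ck_curve_on k S f" "Ck_curve_on k S g" using Suc.prems Ck_curve_on_SucD by blast+
  ultimately show ?case unfolding Ck_curve_on.simps
    using Suc.IH by (intro exI[of _ "\<lambda>t. h (f t) (g' t) + h (f' t) (g t)"])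
     (auto intro: bounded_bilinear.has_vector_derivative[OF h] Ck_curve_on_add)
qed

lemma Ck_curve_on_inverse:
  fixes f :: "real \<Rightarrow> real"
  shows "Ck_curve_on k S f \<Longrightarrow> (\<And>t. t \<in> S \<Longrightarrow> f t \<noteq> 0) \<Longrightarrow> Ck_curve_on k S (\<lambda>t. inverse (f t))"
proof (induction k)
  case 0
  then show ?case by (simp add: continuous_on_inverse)
next
  case (Suc k)
  from Suc.prems obtain f' where 1: "\<forall>t\<in>S. (f has_vector_derivative f' t) (at t within S)" "Ck_curve_on k S f'"
    by auto
  have inv: "Ck_curve_on k S (\<lambda>t. inverse (f t))"
    using Suc.IH[OF Ck_curve_on_SucD[OF Suc.prems(1)]] Suc.prems(2) by simp
  have "Ck_curve_on k S (\<lambda>t. inverse (f t) * f' t * inverse (f t))"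
    by (intro Ck_curve_on_bilinear[OF bounded_bilinear_mult] inv 1)
  then have "Ck_curve_on k S (\<lambda>t. - (inverse (f t) * f' t * inverse (f t)))"
    by (rule Ck_curve_on_linear[OF _ bounded_linear_minus[OF bounded_linear_ident]])
  moreover have "((\<lambda>t. inverse (f t)) has_vector_derivative - (inverse (f t) * f' t * inverse (f t))) (at t within S)"
    if "t \<in> S" for t
    using 1(1) Suc.prems(2) that unfolding has_real_derivative_iff_has_vector_derivative[symmetric]
    by (intro DERIV_inverse') simp_all
  ultimately show ?case unfolding Ck_curve_on.simps
    by (intro exI[of _ "\<lambda>t. - (inverse (f t) * f' t * inverse (f t))"]) simp
qed

lemma Ck_curve_on_sum:
  "(\<And>i. i \<in> F \<Longrightarrow> Ck_curve_on k S (f i)) \<Longrightarrow> Ck_curve_on k S (\<lambda>t. \<Sum>i\<in>F. f i t)"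
  by (induction F rule: infinite_finite_induct) (simp_all add: Ck_curve_on_const Ck_curve_on_add)

lemma Ck_curve_on_prod:
  fixes f :: "'j \<Rightarrow> real \<Rightarrow> real"
  shows "(\<And>i. i \<in> F \<Longrightarrow> Ck_curve_on k S (f i)) \<Longrightarrow> Ck_curve_on k S (\<lambda>t. \<Prod>i\<in>F. f i t)"
  by (induction F rule: infinite_finite_induct)
    (simp_all add: Ck_curve_on_const Ck_curve_on_bilinear[OF bounded_bilinear_mult])

text \<open>\<open>Ck_on\<close> controls derivatives in one fixed direction at a time, whereas the
  chain rule asks for the moving direction \<gamma>'(t). Expanding \<gamma>' in the basis turns the
  derivative into a finite sum of products to which the induction hypothesis applies.\<close>

lemma Ck_curve_on_compose:
  fixes h :: "'a::euclidean_space \<Rightarrow> 'b::real_normed_vector"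
  shows "Ck_on k W h \<Longrightarrow> Ck_curve_on k S \<gamma> \<Longrightarrow> \<gamma> ` S \<subseteq> W \<Longrightarrow> Ck_curve_on k S (\<lambda>t. h (\<gamma> t))"
proof (induction k arbitrary: h)
  case 0
  then show ?case by (auto intro: continuous_on_compose2)
next
  case (Suc k)
  from Suc.prems obtain \<gamma>' where g: "\<forall>t\<in>S. (\<gamma> has_vector_derivative \<gamma>' t) (at t within S)" "Ck_curve_on k S \<gamma>'"
    by auto
  have h: "\<And>x. x \<in> W \<Longrightarrow> h differentiable (at x)" "\<And>v. Ck_on k W (\<lambda>x. frechet_derivative h (at x) v)"
    using Suc.prems by auto
  have lin: "linear (frechet_derivative h (at x))" if "x \<in> W" for x
    using h(1)[OF that] by (rule linear_frechet_derivative)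
  let ?d = "\<lambda>t. \<Sum>b\<in>Basis. (\<gamma>' t \<bullet> b) *\<^sub>R frechet_derivative h (at (\<gamma> t)) b"
  have "Ck_curve_on k S ?d"
    using Suc.IH[OF h(2)] Suc.prems(2,3) Ck_curve_on_SucD
    by (intro Ck_curve_on_sum Ck_curve_on_bilinear[OF bounded_bilinear_scaleR]
        Ck_curve_on_linear[OF g(2) bounded_linear_inner_left]) blast
  moreover have "((\<lambda>t. h (\<gamma> t)) has_vector_derivative ?d t) (at t within S)" if "t \<in> S" for t
  proof -
    have W: "\<gamma> t \<in> W" using that Suc.prems by auto
    have "((\<lambda>t. h (\<gamma> t)) has_derivative (\<lambda>r. frechet_derivative h (at (\<gamma> t)) (r *\<^sub>R \<gamma>' t))) (at t within S)"
      using has_derivative_compose[of \<gamma> "\<lambda>r. r *\<^sub>R \<gamma>' t" t S h] g(1) that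
        h(1)[OF W, unfolded frechet_derivative_works]
      unfolding has_vector_derivative_def by blast
    moreover have "frechet_derivative h (at (\<gamma> t)) (r *\<^sub>R \<gamma>' t) = r *\<^sub>R ?d t" for r
    proof -
      have "frechet_derivative h (at (\<gamma> t)) (\<Sum>b\<in>Basis. (\<gamma>' t \<bullet> b) *\<^sub>R b) = ?d t"
        by (simp only: linear_sum[OF lin[OF W]] linear_cmul[OF lin[OF W]])
      then show ?thesis
        unfolding euclidean_representation by (simp add: linear_cmul[OF lin[OF W]])
    qed
    ultimately show ?thesis unfolding has_vector_derivative_def by simp
  qed
  ultimately show ?case unfolding Ck_curve_on.simps by (intro exI[of _ ?d]) simp
qed

lemma smooth_curve_onD: "smooth_curve_on S f \<Longrightarrow> Ck_curve_on k S f"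
  by (simp add: smooth_curve_on_def)

lemma smooth_curve_on_imp_continuous_on: "smooth_curve_on S f \<Longrightarrow> continuous_on S f"
  using Ck_curve_on_imp_continuous_on smooth_curve_onD by blast

lemma smooth_curve_on_subset: "smooth_curve_on S f \<Longrightarrow> T \<subseteq> S \<Longrightarrow> smooth_curve_on T f"
  unfolding smooth_curve_on_def using Ck_curve_on_subset by blast

lemma smooth_curve_on_cong:
  "smooth_curve_on S f \<Longrightarrow> (\<And>t. t \<in> S \<Longrightarrow> g t = f t) \<Longrightarrow> smooth_curve_on S g"
  unfolding smooth_curve_on_def using Ck_curve_on_cong by blast

lemma smooth_curve_on_const: "smooth_curve_on S (\<lambda>_. c)"
  by (simp add: smooth_curve_on_def Ck_curve_on_const)

lemma smooth_curve_on_linear: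
  "smooth_curve_on S f \<Longrightarrow> bounded_linear h \<Longrightarrow> smooth_curve_on S (\<lambda>t. h (f t))"
  by (simp add: smooth_curve_on_def Ck_curve_on_linear)

lemma smooth_curve_on_add:
  "smooth_curve_on S f \<Longrightarrow> smooth_curve_on S g \<Longrightarrow> smooth_curve_on S (\<lambda>t. f t + g t)"
  by (simp add: smooth_curve_on_def Ck_curve_on_add)

lemma smooth_curve_on_bilinear:
  "bounded_bilinear h \<Longrightarrow> smooth_curve_on S f \<Longrightarrow> smooth_curve_on S g \<Longrightarrow> smooth_curve_on S (\<lambda>t. h (f t) (g t))"
  by (simp add: smooth_curve_on_def Ck_curve_on_bilinear)

lemma smooth_curve_on_diff:
  "smooth_curve_on S f \<Longrightarrow> smooth_curve_on S g \<Longrightarrow> smooth_curve_on S (\<lambda>t. f t - g t)"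
  using smooth_curve_on_add[of S f "\<lambda>t. - g t"]
    smooth_curve_on_linear[OF _ bounded_linear_minus[OF bounded_linear_ident], of S g] by simp

lemmas smooth_curve_on_mult = smooth_curve_on_bilinear[OF bounded_bilinear_mult]
lemmas smooth_curve_on_scaleR = smooth_curve_on_bilinear[OF bounded_bilinear_scaleR]

lemma smooth_curve_on_divide:
  fixes f g :: "real \<Rightarrow> real"
  shows "smooth_curve_on S f \<Longrightarrow> smooth_curve_on S g \<Longrightarrow> (\<And>t. t \<in> S \<Longrightarrow> g t \<noteq> 0)
    \<Longrightarrow> smooth_curve_on S (\<lambda>t. f t / g t)"
  unfolding divide_inverse
  by (intro smooth_curve_on_mult) (simp_all add: smooth_curve_on_def Ck_curve_on_inverse)

lemma smooth_curve_on_sum: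
  "(\<And>i. i \<in> F \<Longrightarrow> smooth_curve_on S (f i)) \<Longrightarrow> smooth_curve_on S (\<lambda>t. \<Sum>i\<in>F. f i t)"
  by (simp add: smooth_curve_on_def Ck_curve_on_sum)

lemma smooth_curve_on_prod:
  fixes f :: "'j \<Rightarrow> real \<Rightarrow> real"
  shows "(\<And>i. i \<in> F \<Longrightarrow> smooth_curve_on S (f i)) \<Longrightarrow> smooth_curve_on S (\<lambda>t. \<Prod>i\<in>F. f i t)"
  by (simp add: smooth_curve_on_def Ck_curve_on_prod)

lemma smooth_curve_on_compose:
  "smooth_on W h \<Longrightarrow> smooth_curve_on S \<gamma> \<Longrightarrow> \<gamma> ` S \<subseteq> W \<Longrightarrow> smooth_curve_on S (\<lambda>t. h (\<gamma> t))"
  unfolding smooth_curve_on_def smooth_on_def by (blast intro: Ck_curve_on_compose)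

lemma smooth_curve_on_component:
  "smooth_curve_on S f \<Longrightarrow> smooth_curve_on S (\<lambda>t. f t $ i)"
  by (rule smooth_curve_on_linear[OF _ bounded_linear_vec_nth])

lemma vec_as_sum_axis:
  fixes x :: "real ^ 'i::finite"
  shows "x = (\<Sum>i\<in>UNIV. x $ i *\<^sub>R axis i 1)"
  using basis_expansion[of x] by (simp add: scalar_mult_eq_scaleR)

lemma smooth_curve_on_vec:
  fixes f :: "'i::finite \<Rightarrow> real \<Rightarrow> real"
  assumes "\<And>i. smooth_curve_on S (f i)"
  shows "smooth_curve_on S (\<lambda>t. \<chi> i. f i t)"
proof -
  have "(\<chi> i. f i t) = (\<Sum>i\<in>UNIV. f i t *\<^sub>R axis i 1)" for t
    using vec_as_sum_axis[of "\<chi> i. f i t"] by simp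
  then show ?thesis
    by (simp only:) (intro smooth_curve_on_sum smooth_curve_on_scaleR smooth_curve_on_const assms)
qed

lemma smooth_curve_on_Pair:
  fixes f :: "real \<Rightarrow> 'a::real_normed_vector" and g :: "real \<Rightarrow> 'b::real_normed_vector"
  assumes "smooth_curve_on S f" "smooth_curve_on S g"
  shows "smooth_curve_on S (\<lambda>t. (f t, g t))"
proof -
  have "smooth_curve_on S (\<lambda>t. (f t, 0) + (0, g t) :: 'a \<times> 'b)"
    by (intro smooth_curve_on_add smooth_curve_on_linear[OF assms(1)] smooth_curve_on_linear[OF assms(2)]
       bounded_linear_Pair bounded_linear_ident bounded_linear_zero)
  then show ?thesis by simp
qed

lemma smooth_curve_on_det:
  fixes M :: "real \<Rightarrow> real ^ 'i ^ 'i::finite"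
  assumes "\<And>i j. smooth_curve_on S (\<lambda>t. M t $ i $ j)"
  shows "smooth_curve_on S (\<lambda>t. det (M t))"
  unfolding det_def by (intro smooth_curve_on_sum smooth_curve_on_mult smooth_curve_on_const smooth_curve_on_prod assms)

text \<open>As \<open>S\<close> is relatively open in \<open>I\<close>, the filters within
  \<open>S\<close> and within \<open>I\<close> agree at points of \<open>S\<close>. This links
  \<open>Ck_curve_on\<close>, which differentiates within \<open>S\<close>, to the geodesic equation
  and \<open>cov_deriv\<close>, which differentiate within \<open>I\<close>.\<close>

lemma smooth_curve_on_has_vector_derivative:
  assumes "smooth_curve_on S f" "openin (top_of_set I) S" "t \<in> S"
  shows "(f has_vector_derivative vector_derivative f (at t within I)) (at t within I)"
proof -
  obtain U where U: "open U" "S = I \<inter> U" using assms openin_open by metis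
  have e: "at t within S = at t within I"
    using assms(3) U by (intro at_within_nhd[of t U]) auto
  have "Ck_curve_on (Suc 0) S f" using assms by (intro smooth_curve_onD)
  then obtain f' where "(f has_vector_derivative f') (at t within I)"
    using assms(3) e by auto
  then show ?thesis using vector_derivative_works differentiableI_vector by blast
qed

text \<open>Each order \<open>k\<close> comes with its own witness \<open>f'\<close>. Uniqueness of
  derivatives, for which the filter within \<open>I\<close> must be nontrivial, identifies all of
  them with \<open>vector_derivative\<close>.\<close>

lemma smooth_curve_on_vector_derivative:
  assumes f: "smooth_curve_on S f" and S: "openin (top_of_set I) S"
    and I: "\<And>t. t \<in> I \<Longrightarrow> at t within I \<noteq> bot"
  shows "smooth_curve_on S (\<lambda>t. vector_derivative f (at t within I))"
  unfolding smooth_curve_on_def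
proof
  fix k
  obtain U where U: "open U" "S = I \<inter> U" using S openin_open by metis
  have e: "at t within S = at t within I" if "t \<in> S" for t
    using that U by (intro at_within_nhd[of t U]) auto
  have "Ck_curve_on (Suc k) S f" using f by (rule smooth_curve_onD)
  then obtain f' where f': "\<forall>t\<in>S. (f has_vector_derivative f' t) (at t within S)" "Ck_curve_on k S f'"
    by auto
  show "Ck_curve_on k S (\<lambda>t. vector_derivative f (at t within I))"
  proof (rule Ck_curve_on_cong[OF f'(2)])
    fix t assume "t \<in> S"
    then have "(f has_vector_derivative f' t) (at t within I)" "t \<in> I" using e f' U(2) by auto
    then show "vector_derivative f (at t within I) = f' t"
      using I by (simp add: vector_derivative_within)
  qed
qed

text \<open>A connected set with more than one point has no isolated points. This makes derivatives
  within the interval unique, also at its end points.\<close>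

lemma interval_at_within_ne_bot:
  fixes I :: "real set"
  assumes "is_interval I" "a \<in> I" "b \<in> I" "a < b" "t \<in> I"
  shows "at t within I \<noteq> bot"
proof -
  have "I \<noteq> {x}" for x using assms(2-4) by force
  then have "t islimpt I"
    using assms(1,5) by (intro connected_imp_perfect) (simp_all add: is_interval_connected)
  then show ?thesis by (simp add: trivial_limit_within)
qed

section \<open>Fibre derivatives and charts\<close>

lemma smooth_on_differentiable: "smooth_on W f \<Longrightarrow> x \<in> W \<Longrightarrow> f differentiable (at x)"
  unfolding smooth_on_def using Ck_on.simps(2) by blast

lemma smooth_on_frechet_derivative: "smooth_on W f \<Longrightarrow> smooth_on W (\<lambda>x. frechet_derivative f (at x) v)"
  unfolding smooth_on_def using Ck_on.simps(2) by blast

lemma smooth_on_dv: "smooth_on W f \<Longrightarrow> smooth_on W (dv i f)"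
  using smooth_on_frechet_derivative[of W f "(0, axis i 1)"] by (simp add: dv_def[abs_def])

lemma vec_as_sum_axis_linear:
  fixes w :: "real ^ 'i::finite"
  assumes "linear T"
  shows "T w = (\<Sum>i\<in>UNIV. w $ i *\<^sub>R T (axis i 1))"
proof -
  have "T (\<Sum>i\<in>UNIV. w $ i *\<^sub>R axis i 1) = (\<Sum>i\<in>UNIV. w $ i *\<^sub>R T (axis i 1))"
    by (simp only: linear_sum[OF assms] linear_cmul[OF assms])
  then show ?thesis using vec_as_sum_axis[of w] by simp
qed

lemma frechet_derivative_dx_dv:
  assumes "f differentiable (at z)"
  shows "frechet_derivative f (at z) (a, b) = (\<Sum>i\<in>UNIV. a $ i * dx i f z) + (\<Sum>i\<in>UNIV. b $ i * dv i f z)"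
proof -
  let ?D = "frechet_derivative f (at z)"
  have lin: "linear ?D" using assms by (rule linear_frechet_derivative)
  have "linear (\<lambda>a. ?D (a, 0))" "linear (\<lambda>b. ?D (0, b))"
    using linear_cmul[OF lin, of _ "(_, 0)"] linear_cmul[OF lin, of _ "(0, _)"]
    by (auto intro!: linearI simp flip: linear_add[OF lin])
  from vec_as_sum_axis_linear[OF this(1), of a] vec_as_sum_axis_linear[OF this(2), of b]
  show ?thesis
    using linear_add[OF lin, of "(a, 0)" "(0, b)"] by (simp add: dx_def dv_def)
qed

lemma fibre_has_derivative:
  assumes "f differentiable (at (p, w))"
  shows "((\<lambda>w. f (p, w)) has_derivative (\<lambda>u. \<Sum>i\<in>UNIV. u $ i * dv i f (p, w))) (at w)"
proof -
  have "((\<lambda>w. (p, w)) has_derivative (\<lambda>u. (0, u))) (at w)"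
    by (auto intro!: derivative_eq_intros)
  from has_derivative_compose[OF this assms[unfolded frechet_derivative_works]] show ?thesis
    by (simp add: frechet_derivative_dx_dv[OF assms])
qed

text \<open>\<open>dv\<close> is defined through the total derivative at a pair; once that exists,
  it may be computed with the base point frozen.\<close>

lemma dv_eqI:
  assumes "f differentiable (at (p, w))" "((\<lambda>w. f (p, w)) has_derivative D) (at w)"
  shows "dv i f (p, w) = D (axis i 1)"
proof -
  have "D = (\<lambda>u. \<Sum>i\<in>UNIV. u $ i * dv i f (p, w))"
    using fibre_has_derivative[OF assms(1)] assms(2) has_derivative_unique by blast
  then show ?thesis by (simp add: axis_def if_distrib[of "\<lambda>x. x * _"] cong: if_cong)
qed

text \<open>The base point is frozen on both sides, so no derivative of a coordinate change beyond
  the linear map \<open>T\<close> enters. This is why fibre derivatives transform as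
  tensors.\<close>

lemma dv_pullback:
  assumes f: "f differentiable (at (p, w))" and g: "g differentiable (at (q, T w))" and T: "linear T"
    and W: "open W" "w \<in> W" "\<And>u. u \<in> W \<Longrightarrow> f (p, u) = g (q, T u)"
  shows "dv i f (p, w) = (\<Sum>j\<in>UNIV. T (axis i 1) $ j * dv j g (q, T w))"
proof -
  have "(T has_derivative T) (at w)"
    using T by (simp add: linear_imp_has_derivative)
  from has_derivative_compose[OF this fibre_has_derivative[OF g]]
  have "((\<lambda>u. g (q, T u)) has_derivative (\<lambda>u. \<Sum>j\<in>UNIV. T u $ j * dv j g (q, T w))) (at w)" .
  then have "((\<lambda>u. f (p, u)) has_derivative (\<lambda>u. \<Sum>j\<in>UNIV. T u $ j * dv j g (q, T w))) (at w)"
    by (rule has_derivative_transform_within_open[OF _ W(1,2)]) (simp add: W(3))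
  from dv_eqI[OF f this] show ?thesis by simp
qed

text \<open>The homogeneity relation is differentiated in the factor \<open>a\<close> at a =
  1.\<close>

lemma euler_homogeneous:
  assumes f: "f differentiable (at (p, w))" and h: "\<And>a. a > 0 \<Longrightarrow> f (p, a *\<^sub>R w) = a ^ k * f (p, w)"
  shows "(\<Sum>i\<in>UNIV. w $ i * dv i f (p, w)) = k * f (p, w)"
proof -
  have "((\<lambda>a. a *\<^sub>R w) has_derivative (\<lambda>a. a *\<^sub>R w)) (at 1)"
    by (auto intro!: derivative_eq_intros)
  then have "((\<lambda>a. f (p, a *\<^sub>R w)) has_derivative (\<lambda>a. \<Sum>i\<in>UNIV. (a *\<^sub>R w) $ i * dv i f (p, w))) (at 1)"
    by (rule has_derivative_compose[of _ _ _ _ "\<lambda>w. f (p, w)"]) (simp add: fibre_has_derivative[OF f])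
  then have 1: "((\<lambda>a. a ^ k * f (p, w)) has_derivative (\<lambda>a. \<Sum>i\<in>UNIV. (a *\<^sub>R w) $ i * dv i f (p, w))) (at 1)"
    by (rule has_derivative_transform_within_open[of _ _ _ _ "{0<..}"]) (simp_all add: h)
  have "((\<lambda>a. a ^ k * f (p, w)) has_derivative (\<lambda>a. a * (k * f (p, w)))) (at 1)"
    by (auto intro!: derivative_eq_intros)
  from has_derivative_unique[OF 1 this] show ?thesis
    by (metis (no_types, lifting) lambda_one mult.left_neutral scaleR_one sum.cong)
qed

text \<open>Two derivatives of f(p, a w) in w are compared: the chain rule produces a factor a,
  homogeneity a factor a^(k+1), so the degree drops by one.\<close>

lemma dv_homogeneous:
  assumes f: "\<And>w. w \<noteq> 0 \<Longrightarrow> f differentiable (at (p, w))" and a: "a > 0" and w: "w \<noteq> 0"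
    and h: "\<And>w. w \<noteq> 0 \<Longrightarrow> f (p, a *\<^sub>R w) = a ^ Suc k * f (p, w)"
  shows "dv i f (p, a *\<^sub>R w) = a ^ k * dv i f (p, w)"
proof -
  have "((\<lambda>u. a ^ Suc k * f (p, u)) has_derivative (\<lambda>u. \<Sum>j\<in>UNIV. (a *\<^sub>R u) $ j * dv j f (p, a *\<^sub>R w))) (at w)"
  proof (rule has_derivative_transform_within_open[of _ _ _ _ "- {0}"])
    have "((\<lambda>u. a *\<^sub>R u) has_derivative (\<lambda>u. a *\<^sub>R u)) (at w)"
      by (auto intro!: derivative_eq_intros)
    from has_derivative_compose[OF this fibre_has_derivative[OF f]]
    show "((\<lambda>u. f (p, a *\<^sub>R u)) has_derivative (\<lambda>u. \<Sum>j\<in>UNIV. (a *\<^sub>R u) $ j * dv j f (p, a *\<^sub>R w))) (at w)"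
      using a w by simp
  qed (use w h in auto)
  moreover have "((\<lambda>u. a ^ Suc k * f (p, u)) has_derivative (\<lambda>u. a ^ Suc k * (\<Sum>j\<in>UNIV. u $ j * dv j f (p, w)))) (at w)"
    by (intro has_derivative_mult_right fibre_has_derivative f w)
  ultimately have "(\<lambda>u. \<Sum>j\<in>UNIV. (a *\<^sub>R u) $ j * dv j f (p, a *\<^sub>R w)) =
      (\<lambda>u. a ^ Suc k * (\<Sum>j\<in>UNIV. u $ j * dv j f (p, w)))"
    by (rule has_derivative_unique)
  from fun_cong[OF this, of "axis i 1"]
  have "a * dv i f (p, a *\<^sub>R w) = a ^ Suc k * dv i f (p, w)"
    by (simp add: axis_def if_distrib[of "\<lambda>x. x * _"] if_distrib[of "\<lambda>x. _ * x"] cong: if_cong)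
  then show ?thesis using a by simp
qed

section \<open>Tangent spaces described through charts\<close>

locale smooth_manifold =
  fixes A :: "('m::{t2_space, second_countable_topology}, 'i::finite) chart set"
  assumes atlas: "smooth_atlas A"
begin

abbreviation trans_deriv :: "('m, 'i) chart \<Rightarrow> ('m, 'i) chart \<Rightarrow> 'm \<Rightarrow> real ^ 'i \<Rightarrow> real ^ 'i" where
  "trans_deriv c d x \<equiv> frechet_derivative (transition c d) (at (snd c x))"

lemma chart_inv_left: "c \<in> A \<Longrightarrow> x \<in> fst c \<Longrightarrow> chart_inv c (snd c x) = x"
  using atlas unfolding smooth_atlas_def homeomorphism_def by blast

lemma ex_chart: "\<exists>c\<in>A. x \<in> fst c"
  using atlas unfolding smooth_atlas_def by blast

lemma open_chart: "c \<in> A \<Longrightarrow> open (fst c)"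
  using atlas unfolding smooth_atlas_def by blast

lemma open_chart_image: "c \<in> A \<Longrightarrow> open (snd c ` fst c)"
  using atlas unfolding smooth_atlas_def by blast

lemma open_chart_image_Int:
  assumes "c \<in> A" "open U"
  shows "open (snd c ` (fst c \<inter> U))"
proof -
  have h: "homeomorphism (fst c) (snd c ` fst c) (snd c) (chart_inv c)" and o: "open (snd c ` fst c)"
    using atlas assms unfolding smooth_atlas_def by blast+
  have "openin (top_of_set (snd c ` fst c)) (snd c ` (fst c \<inter> U))"
    using homeomorphism_imp_open_map[OF h] assms by blast
  then show ?thesis using o openin_open_trans by blast
qed

lemma transition_differentiable:
  "c \<in> A \<Longrightarrow> d \<in> A \<Longrightarrow> x \<in> fst c \<inter> fst d \<Longrightarrow> transition c d differentiable (at (snd c x))"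
  using atlas unfolding smooth_atlas_def by (blast intro: smooth_on_differentiable)

lemma linear_trans_deriv:
  "c \<in> A \<Longrightarrow> d \<in> A \<Longrightarrow> x \<in> fst c \<inter> fst d \<Longrightarrow> linear (trans_deriv c d x)"
  by (intro linear_frechet_derivative transition_differentiable)

lemma transition_apply: "c \<in> A \<Longrightarrow> x \<in> fst c \<Longrightarrow> transition c d (snd c x) = snd d x"
  by (simp add: transition_def chart_inv_left)

text \<open>This is the chain rule. The two coordinate changes agree only on the image of the triple
  overlap, but that is an open neighbourhood of the point. It is the compatibility behind
  \<open>tvec_of_in_tangent_space\<close>.\<close>

lemma trans_deriv_cocycle:
  assumes A: "c \<in> A" "d \<in> A" "e \<in> A" and x: "x \<in> fst c" "x \<in> fst d" "x \<in> fst e"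
  shows "trans_deriv d e x (trans_deriv c d x w) = trans_deriv c e x w"
proof -
  have "(transition d e has_derivative trans_deriv d e x) (at (transition c d (snd c x)))"
    using transition_differentiable[of d e x] A x
    by (simp add: frechet_derivative_works transition_apply)
  moreover have "(transition c d has_derivative trans_deriv c d x) (at (snd c x))"
    using transition_differentiable[of c d x] A x by (simp add: frechet_derivative_works)
  ultimately have "((\<lambda>p. transition d e (transition c d p)) has_derivative
      (\<lambda>w. trans_deriv d e x (trans_deriv c d x w))) (at (snd c x))"
    by (rule has_derivative_compose[rotated])
  then have "(transition c e has_derivative (\<lambda>w. trans_deriv d e x (trans_deriv c d x w))) (at (snd c x))"
    by (rule has_derivative_transform_within_open[of _ _ _ _ "snd c ` (fst c \<inter> (fst d \<inter> fst e))"])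
      (use A x in \<open>auto intro!: open_chart_image_Int simp: open_chart open_Int transition_apply\<close>)
  then show ?thesis using frechet_derivative_at by metis
qed

lemma trans_deriv_refl:
  assumes "c \<in> A" "x \<in> fst c"
  shows "trans_deriv c c x w = w"
proof -
  have "((\<lambda>p. p) has_derivative (\<lambda>w. w)) (at (snd c x))" by simp
  then have "(transition c c has_derivative (\<lambda>w. w)) (at (snd c x))"
    by (rule has_derivative_transform_within_open[of _ _ _ _ "snd c ` fst c"])
      (use assms in \<open>auto simp: open_chart_image transition_apply\<close>)
  then show ?thesis using frechet_derivative_at by metis
qed

lemma tvec_of_in_tangent_space:
  "c \<in> A \<Longrightarrow> x \<in> fst c \<Longrightarrow> tvec_of A c x w \<in> tangent_space A x"
  unfolding tangent_space_def tvec_of_def by (auto simp: trans_deriv_cocycle)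

lemma tvec_of_apply_same: "c \<in> A \<Longrightarrow> x \<in> fst c \<Longrightarrow> tvec_of A c x w c = w"
  by (simp add: tvec_of_def trans_deriv_refl)

lemma tangent_space_trans_deriv:
  "v \<in> tangent_space A x \<Longrightarrow> c \<in> A \<Longrightarrow> d \<in> A \<Longrightarrow> x \<in> fst c \<Longrightarrow> x \<in> fst d \<Longrightarrow> v d = trans_deriv c d x (v c)"
  unfolding tangent_space_def by blast

lemma tangent_space_outside: "v \<in> tangent_space A x \<Longrightarrow> \<not> (c \<in> A \<and> x \<in> fst c) \<Longrightarrow> v c = 0"
  unfolding tangent_space_def by blast

lemma tvec_of_tangent:
  assumes "v \<in> tangent_space A x" "c \<in> A" "x \<in> fst c"
  shows "tvec_of A c x (v c) = v"
proof
  fix d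
  show "tvec_of A c x (v c) d = v d"
    using assms tangent_space_trans_deriv[OF assms(1,2), of d]
      tangent_space_outside[OF assms(1), of d]
    by (cases "d \<in> A \<and> x \<in> fst d") (auto simp: tvec_of_def)
qed

text \<open>One chart determines all components, by transition derivatives on overlaps and by the
  value 0 elsewhere. Identities of tangent vectors are reduced to coordinates in this way.\<close>

lemma tangent_space_eqI:
  "u \<in> tangent_space A x \<Longrightarrow> v \<in> tangent_space A x \<Longrightarrow> c \<in> A \<Longrightarrow> x \<in> fst c \<Longrightarrow> u c = v c \<Longrightarrow> u = v"
  using tvec_of_tangent by metis

lemma tvec_of_add:
  "c \<in> A \<Longrightarrow> x \<in> fst c \<Longrightarrow> tvec_of A c x (u + w) = tvec_of A c x u + tvec_of A c x w"
  by (auto simp: tvec_of_def fun_eq_iff linear_add[OF linear_trans_deriv])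

lemma tvec_of_scale:
  "c \<in> A \<Longrightarrow> x \<in> fst c \<Longrightarrow> tvec_of A c x (a *\<^sub>R w) = tscale a (tvec_of A c x w)"
  by (auto simp: tvec_of_def tscale_def fun_eq_iff linear_cmul[OF linear_trans_deriv])

lemma tangent_space_add:
  assumes "u \<in> tangent_space A x" "v \<in> tangent_space A x"
  shows "u + v \<in> tangent_space A x"
proof -
  obtain c where c: "c \<in> A" "x \<in> fst c" using ex_chart by blast
  then have "u + v = tvec_of A c x (u c + v c)"
    using assms by (simp add: tvec_of_add tvec_of_tangent)
  then show ?thesis using c tvec_of_in_tangent_space by simp
qed

lemma tangent_space_tscale:
  assumes "u \<in> tangent_space A x"
  shows "tscale a u \<in> tangent_space A x"
proof -
  obtain c where c: "c \<in> A" "x \<in> fst c" using ex_chart by blast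
  then have "tscale a u = tvec_of A c x (a *\<^sub>R u c)"
    using assms by (simp add: tvec_of_scale tvec_of_tangent)
  then show ?thesis using c tvec_of_in_tangent_space by simp
qed

end

section \<open>The metric of a Lorentz-Finsler structure: homogeneity, symmetry, change of
  charts\<close>

locale lorentz_finsler_manifold = smooth_manifold A
  for A :: "('m::{t2_space, second_countable_topology}, 'i::finite) chart set" +
  fixes L :: "'m \<Rightarrow> ('m, 'i) tvec \<Rightarrow> real"
  assumes lf: "lorentz_finsler A L"
begin

abbreviation Lc :: "('m, 'i) chart \<Rightarrow> (real ^ 'i) \<times> (real ^ 'i) \<Rightarrow> real" where
  "Lc c \<equiv> in_chart A c L"

abbreviation slit :: "('m, 'i) chart \<Rightarrow> ((real ^ 'i) \<times> (real ^ 'i)) set" where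
  "slit c \<equiv> snd c ` fst c \<times> (UNIV - {0})"

lemma open_slit: "c \<in> A \<Longrightarrow> open (slit c)"
  by (intro open_Times open_chart_image) auto

lemma Lc_smooth: "c \<in> A \<Longrightarrow> smooth_on (slit c) (Lc c)"
  using lf by (simp add: lorentz_finsler_def)

lemma met_smooth: "c \<in> A \<Longrightarrow> smooth_on (slit c) (met (Lc c) i j)"
  by (simp add: met_def smooth_on_dv Lc_smooth)

lemma Lc_apply: "c \<in> A \<Longrightarrow> x \<in> fst c \<Longrightarrow> Lc c (snd c x, w) = L x (tvec_of A c x w)"
  by (simp add: in_chart_def chart_inv_left)

lemma Lc_homogeneous:
  assumes "c \<in> A" "x \<in> fst c" "a > 0"
  shows "Lc c (snd c x, a *\<^sub>R w) = a\<^sup>2 * Lc c (snd c x, w)"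
  using lf assms unfolding lorentz_finsler_def
  by (simp add: Lc_apply tvec_of_scale tvec_of_in_tangent_space)

lemma slit_iff: "(p, w) \<in> slit c \<longleftrightarrow> (\<exists>x\<in>fst c. p = snd c x) \<and> w \<noteq> 0"
  by auto

lemma euler_Lc:
  assumes "c \<in> A" "z \<in> slit c"
  shows "(\<Sum>i\<in>UNIV. snd z $ i * dv i (Lc c) z) = 2 * Lc c z"
proof -
  obtain x w where z: "z = (snd c x, w)" "x \<in> fst c" "w \<noteq> 0" using assms(2) by auto
  show ?thesis
    using euler_homogeneous[of "Lc c" "snd c x" w 2] smooth_on_differentiable[OF Lc_smooth assms(2)] assms(1) z
      Lc_homogeneous by simp
qed

text \<open>In invariant terms g_v(v, .) = dL at v. The fibre derivative of \<open>L\<close> is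
  homogeneous of degree 1, so Euler's relation applies to it in turn.\<close>

lemma euler_dv_Lc:
  assumes "c \<in> A" "z \<in> slit c"
  shows "(\<Sum>i\<in>UNIV. snd z $ i * met (Lc c) i j z) = dv j (Lc c) z"
proof -
  obtain x w where z: "z = (snd c x, w)" "x \<in> fst c" "w \<noteq> 0" using assms(2) by auto
  have diff: "Lc c differentiable (at (snd c x, u))" "dv j (Lc c) differentiable (at (snd c x, u))" if "u \<noteq> 0" for u
    using smooth_on_differentiable Lc_smooth smooth_on_dv assms z that by (metis slit_iff)+
  have "dv j (Lc c) (snd c x, a *\<^sub>R w) = a ^ 1 * dv j (Lc c) (snd c x, w)" if "a > 0" for a
    using that z assms Lc_homogeneous[of c x a] diff
    by (intro dv_homogeneous) (simp_all add: power2_eq_square)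
  then show ?thesis using euler_homogeneous[of "dv j (Lc c)" "snd c x" w 1] diff z
    by (simp add: met_def)
qed

lemma met_lorentzian:
  assumes "c \<in> A" "z \<in> slit c"
  shows "lorentzian_signature (met_matrix (Lc c) z)"
  using assms lf unfolding lorentz_finsler_def by fastforce

lemma met_sym:
  assumes "c \<in> A" "z \<in> slit c"
  shows "met (Lc c) i j z = met (Lc c) j i z"
proof -
  let ?g = "met_matrix (Lc c) z"
  obtain k and P :: "real ^ 'i ^ 'i" where P: "invertible P" "transpose P ** ?g ** P = (\<chi> i j. if i \<noteq> j then 0 else if i = k then - 1 else 1)"
      (is "_ = ?D")
    using met_lorentzian[OF assms] unfolding lorentzian_signature_def by blast
  obtain Q where Q: "P ** Q = mat 1" "Q ** P = mat 1" using P(1) unfolding invertible_def by blast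
  have Q': "transpose Q ** transpose P = mat 1" by (metis Q(1) matrix_transpose_mul transpose_mat)
  have "transpose Q ** ?D ** Q = (transpose Q ** transpose P) ** ?g ** (P ** Q)"
    unfolding P(2)[symmetric] by (simp add: matrix_mul_assoc)
  also have "\<dots> = ?g" by (simp add: Q Q')
  finally have g: "?g = transpose Q ** ?D ** Q" ..
  have "transpose ?D = ?D" by (auto simp: transpose_def vec_eq_iff)
  then have "transpose ?g = ?g" unfolding g by (simp add: matrix_transpose_mul matrix_mul_assoc)
  from arg_cong[OF this, of "\<lambda>g. g $ j $ i"] show ?thesis by (simp add: transpose_def met_matrix_def)
qed

lemma met_matrix_invertible:
  assumes "c \<in> A" "z \<in> slit c"
  shows "invertible (met_matrix (Lc c) z)"
proof -
  let ?g = "met_matrix (Lc c) z"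
  obtain k and P :: "real ^ 'i ^ 'i" where P: "transpose P ** ?g ** P = (\<chi> i j. if i \<noteq> j then 0 else if i = k then - 1 else 1)"
      (is "_ = ?D")
    using met_lorentzian[OF assms] unfolding lorentzian_signature_def by blast
  have "det ?D = (\<Prod>i\<in>UNIV. if i = k then - 1 else 1)"
    by (subst det_diagonal) auto
  also have "\<dots> \<noteq> 0" by (simp add: prod_zero_iff)
  finally show ?thesis unfolding P[symmetric] by (auto simp: det_mul invertible_det_nz)
qed

lemma met_inv_left:
  assumes "c \<in> A" "z \<in> slit c"
  shows "(\<Sum>i\<in>UNIV. met (Lc c) k i z * met_inv (Lc c) i j z) = (if k = j then 1 else 0)"
proof -
  have "met_matrix (Lc c) z ** matrix_inv (met_matrix (Lc c) z) = mat 1"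
    using met_matrix_invertible[OF assms] unfolding invertible_def matrix_inv_def by (rule someI2_ex) simp
  from arg_cong[OF this, of "\<lambda>M. M $ k $ j"] show ?thesis
    by (simp add: matrix_matrix_mult_def mat_def met_inv_def met_matrix_def)
qed

lemma dx_met_sym:
  assumes "c \<in> A" "z \<in> slit c"
  shows "dx k (met (Lc c) i j) z = dx k (met (Lc c) j i) z"
proof -
  have "met (Lc c) i j differentiable (at z)" using assms by (intro smooth_on_differentiable[OF met_smooth])
  from frechet_derivative_transform_within_open[OF this open_slit[OF assms(1)] assms(2), of "met (Lc c) j i"]
  show ?thesis unfolding dx_def using met_sym assms(1) by simp
qed

text \<open>The Cartan tensor is annihilated by the reference vector. Differentiating
  \<open>euler_dv_Lc\<close> in the k-th fibre direction gives g_kj plus the contraction on one side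
  and g_kj on the other, so no third derivatives of \<open>L\<close> have to be
  interchanged.\<close>

lemma euler_dv_met:
  assumes "c \<in> A" "z \<in> slit c"
  shows "(\<Sum>i\<in>UNIV. snd z $ i * dv k (met (Lc c) i j) z) = 0"
proof -
  obtain p w where z: "z = (p, w)" by fastforce
  have d: "met (Lc c) i j differentiable (at z)" "dv j (Lc c) differentiable (at z)" for i j
    using assms by (auto intro!: smooth_on_differentiable[OF met_smooth]
        smooth_on_differentiable[OF smooth_on_dv[OF Lc_smooth]])
  have "((\<lambda>w. \<Sum>i\<in>UNIV. w $ i * met (Lc c) i j (p, w)) has_derivative
     (\<lambda>u. \<Sum>i\<in>UNIV. w $ i * (\<Sum>k\<in>UNIV. u $ k * dv k (met (Lc c) i j) z) + u $ i * met (Lc c) i j z)) (at w)"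
    using fibre_has_derivative[OF d(1)[unfolded z]]
    by (auto intro!: has_derivative_sum has_derivative_mult bounded_linear.has_derivative[OF bounded_linear_vec_nth]
        simp: z)
  then have "((\<lambda>w. dv j (Lc c) (p, w)) has_derivative
     (\<lambda>u. \<Sum>i\<in>UNIV. w $ i * (\<Sum>k\<in>UNIV. u $ k * dv k (met (Lc c) i j) z) + u $ i * met (Lc c) i j z)) (at w)"
    by (rule has_derivative_transform_within_open[of _ _ _ _ "- {0}"])
      (use assms z euler_dv_Lc[of c "(p, _)"] in auto)
  from dv_eqI[OF d(2)[unfolded z] this, of k]
  have "met (Lc c) k j z = (\<Sum>i\<in>UNIV. w $ i * dv k (met (Lc c) i j) z) + met (Lc c) k j z"
    by (simp add: met_def z sum.distrib axis_def if_distrib[of "\<lambda>x. x * _"] cong: if_cong)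
  then show ?thesis by (simp add: z)
qed

lemma met_form_self:
  assumes "c \<in> A" "z \<in> slit c"
  shows "met_form (Lc c) z (snd z) (snd z) = 2 * Lc c z"
proof -
  have "met_form (Lc c) z (snd z) (snd z) = (\<Sum>j\<in>UNIV. snd z $ j * (\<Sum>i\<in>UNIV. snd z $ i * met (Lc c) i j z))"
    unfolding met_form_def by (subst sum.swap) (simp add: sum_distrib_left mult_ac)
  then show ?thesis using euler_dv_Lc[OF assms] euler_Lc[OF assms] by simp
qed

lemma Lc_transform:
  assumes "c \<in> A" "d \<in> A" "x \<in> fst c" "x \<in> fst d"
  shows "Lc c (snd c x, w) = Lc d (snd d x, trans_deriv c d x w)"
proof -
  have "tvec_of A d x (tvec_of A c x w d) = tvec_of A c x w"
    using assms by (intro tvec_of_tangent tvec_of_in_tangent_space)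
  moreover have "tvec_of A c x w d = trans_deriv c d x w" using assms by (simp add: tvec_of_def)
  ultimately show ?thesis using assms by (simp add: Lc_apply)
qed

lemma trans_deriv_nonzero:
  assumes "c \<in> A" "d \<in> A" "x \<in> fst c" "x \<in> fst d" "w \<noteq> 0"
  shows "trans_deriv c d x w \<noteq> 0"
  by (metis IntI assms linear_0 linear_trans_deriv trans_deriv_cocycle trans_deriv_refl)

text \<open>A change of chart acts linearly on each fibre, so each of the two fibre derivatives of
  \<open>Lc_transform\<close> contributes one factor \<open>T\<close>, and \<open>T\<close> itself
  is never differentiated.\<close>

lemma met_form_transform:
  assumes A: "c \<in> A" "d \<in> A" "x \<in> fst c" "x \<in> fst d" and w: "w \<noteq> 0"
  defines "T \<equiv> trans_deriv c d x"
  shows "met_form (Lc c) (snd c x, w) u u' = met_form (Lc d) (snd d x, T w) (T u) (T u')"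
proof -
  have T: "linear T" unfolding T_def using A by (intro linear_trans_deriv) auto
  have nz: "T w \<noteq> 0" if "w \<noteq> 0" for w unfolding T_def using trans_deriv_nonzero A that .
  have slit: "(snd c x, w) \<in> slit c" "(snd d x, T w) \<in> slit d" if "w \<noteq> 0" for w
    using A that nz by auto
  have 1: "dv j (Lc c) (snd c x, w) = (\<Sum>l\<in>UNIV. T (axis j 1) $ l * dv l (Lc d) (snd d x, T w))" if "w \<noteq> 0" for j w
  proof (rule dv_pullback[OF _ _ T, of _ _ w _ _ "- {0}"])
    show "Lc c differentiable (at (snd c x, w))" "Lc d differentiable (at (snd d x, T w))"
      using slit[OF that] A by (blast intro: smooth_on_differentiable[OF Lc_smooth])+
    show "Lc c (snd c x, u) = Lc d (snd d x, T u)" for u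
      unfolding T_def using Lc_transform A by blast
  qed (use that in auto)
  let ?F = "\<lambda>j z. \<Sum>l\<in>UNIV. T (axis j 1) $ l * dv l (Lc d) z"
  have dF: "((\<lambda>w. ?F j (snd d x, w)) has_derivative (\<lambda>u. \<Sum>l\<in>UNIV. T (axis j 1) $ l * (\<Sum>k\<in>UNIV. u $ k * met (Lc d) k l (snd d x, T w)))) (at (T w))"
    for j unfolding met_def
    using smooth_on_differentiable[OF smooth_on_dv[OF Lc_smooth[OF A(2)]] slit(2)[OF w]]
    by (intro has_derivative_sum has_derivative_mult_right fibre_has_derivative)
  have 2: "met (Lc c) i j (snd c x, w) =
     (\<Sum>l\<in>UNIV. T (axis j 1) $ l * (\<Sum>k\<in>UNIV. T (axis i 1) $ k * met (Lc d) k l (snd d x, T w)))" for i j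
  proof -
    have "(T has_derivative T) (at w)" using T by (simp add: linear_imp_has_derivative)
    from has_derivative_compose[OF this dF]
    have "((\<lambda>w. dv j (Lc c) (snd c x, w)) has_derivative
      (\<lambda>u. \<Sum>l\<in>UNIV. T (axis j 1) $ l * (\<Sum>k\<in>UNIV. T u $ k * met (Lc d) k l (snd d x, T w)))) (at w)"
      by (rule has_derivative_transform_within_open[of _ _ _ _ "- {0}"]) (use w 1 in auto)
    from dv_eqI[OF smooth_on_differentiable[OF smooth_on_dv[OF Lc_smooth[OF A(1)]] slit(1)[OF w]] this]
    show ?thesis by (simp add: met_def)
  qed
  have comp: "T u $ k = (\<Sum>i\<in>UNIV. u $ i * T (axis i 1) $ k)" for u k
    by (subst vec_as_sum_axis_linear[OF T]) simp
  let ?m = "\<lambda>k l. met (Lc d) k l (snd d x, T w)" and ?a = "\<lambda>i. T (axis i 1)"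
  have "met_form (Lc d) (snd d x, T w) (T u) (T u') =
    (\<Sum>k\<in>UNIV. \<Sum>l\<in>UNIV. \<Sum>i\<in>UNIV. \<Sum>j\<in>UNIV. u $ i * u' $ j * (?a j $ l * (?a i $ k * ?m k l)))"
    unfolding met_form_def comp[of u] comp[of u']
    by (simp add: sum_distrib_left sum_distrib_right mult_ac)
  also have "\<dots> = (\<Sum>k\<in>UNIV. \<Sum>i\<in>UNIV. \<Sum>l\<in>UNIV. \<Sum>j\<in>UNIV. u $ i * u' $ j * (?a j $ l * (?a i $ k * ?m k l)))"
    by (intro sum.cong refl sum.swap)
  also have "\<dots> = (\<Sum>i\<in>UNIV. \<Sum>k\<in>UNIV. \<Sum>l\<in>UNIV. \<Sum>j\<in>UNIV. u $ i * u' $ j * (?a j $ l * (?a i $ k * ?m k l)))"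
    by (rule sum.swap)
  also have "\<dots> = (\<Sum>i\<in>UNIV. \<Sum>k\<in>UNIV. \<Sum>j\<in>UNIV. \<Sum>l\<in>UNIV. u $ i * u' $ j * (?a j $ l * (?a i $ k * ?m k l)))"
    by (intro sum.cong refl sum.swap)
  also have "\<dots> = (\<Sum>i\<in>UNIV. \<Sum>j\<in>UNIV. \<Sum>k\<in>UNIV. \<Sum>l\<in>UNIV. u $ i * u' $ j * (?a j $ l * (?a i $ k * ?m k l)))"
    by (intro sum.cong refl sum.swap)
  also have "\<dots> = (\<Sum>i\<in>UNIV. \<Sum>j\<in>UNIV. \<Sum>l\<in>UNIV. \<Sum>k\<in>UNIV. u $ i * u' $ j * (?a j $ l * (?a i $ k * ?m k l)))"
    by (intro sum.cong refl sum.swap)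
  also have "\<dots> = met_form (Lc c) (snd c x, w) u u'"
    unfolding met_form_def 2 by (simp add: sum_distrib_left sum_distrib_right mult_ac)
  finally show ?thesis ..
qed

end

section \<open>Compatibility of the Chern connection with the metric\<close>

lemma met_form_add_right: "met_form l z u (w + w') = met_form l z u w + met_form l z u w'"
  by (simp add: met_form_def distrib_left sum.distrib)

lemma met_form_scale_right: "met_form l z u (a *\<^sub>R w) = a * met_form l z u w"
  by (simp add: met_form_def sum_distrib_left mult_ac)

lemma met_form_zero_right: "met_form l z u 0 = 0"
  by (simp add: met_form_def)

context lorentz_finsler_manifold
begin

text \<open>Lowering an index: the connection coefficients are defined with the inverse metric, and
  this moves later computations to their lowered forms, where the inverse no longer occurs.\<close>

lemma met_inv_cancel:
  assumes "c \<in> A" "z \<in> slit c"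
  shows "(\<Sum>i\<in>UNIV. met (Lc c) j i z * (\<Sum>k\<in>UNIV. met_inv (Lc c) i k z * X k)) = X j"
proof -
  have "(\<Sum>i\<in>UNIV. met (Lc c) j i z * (\<Sum>k\<in>UNIV. met_inv (Lc c) i k z * X k)) =
    (\<Sum>k\<in>UNIV. (\<Sum>i\<in>UNIV. met (Lc c) j i z * met_inv (Lc c) i k z) * X k)"
    unfolding sum_distrib_left sum_distrib_right by (subst sum.swap) (simp add: mult_ac)
  also have "\<dots> = X j"
    unfolding met_inv_left[OF assms] by (simp add: if_distrib[of "\<lambda>x. x * _"] cong: if_cong)
  finally show ?thesis .
qed

text \<open>The formal Christoffel symbols of the first kind, built from base derivatives only, with
  \<open>j\<close> the lowered index.\<close>

definition christoffel :: "('m, 'i) chart \<Rightarrow> (real ^ 'i) \<times> (real ^ 'i) \<Rightarrow> 'i \<Rightarrow> 'i \<Rightarrow> 'i \<Rightarrow> real" where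
  "christoffel c z j \<beta> \<gamma> =
     1 / 2 * (dx \<beta> (met (Lc c) j \<gamma>) z + dx \<gamma> (met (Lc c) \<beta> j) z - dx j (met (Lc c) \<beta> \<gamma>) z)"

lemma lower_Gamma_tilde:
  assumes "c \<in> A" "z \<in> slit c"
  shows "(\<Sum>i\<in>UNIV. met (Lc c) j i z * Gamma_tilde (Lc c) i \<beta> \<gamma> z) = christoffel c z j \<beta> \<gamma>"
proof -
  have "Gamma_tilde (Lc c) i \<beta> \<gamma> z = (\<Sum>\<delta>\<in>UNIV. met_inv (Lc c) i \<delta> z * christoffel c z \<delta> \<beta> \<gamma>)" for i
    unfolding Gamma_tilde_def christoffel_def sum_distrib_left by (simp add: mult_ac)
  then show ?thesis using met_inv_cancel[OF assms] by simp
qed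

lemma lower_spray:
  assumes "c \<in> A" "z \<in> slit c"
  shows "(\<Sum>i\<in>UNIV. met (Lc c) j i z * spray (Lc c) i z) =
    1 / 2 * (\<Sum>\<beta>\<in>UNIV. \<Sum>\<gamma>\<in>UNIV. snd z $ \<beta> * snd z $ \<gamma> * christoffel c z j \<beta> \<gamma>)"
proof -
  have "(\<Sum>i\<in>UNIV. met (Lc c) j i z * spray (Lc c) i z) =
    1 / 2 * (\<Sum>i\<in>UNIV. \<Sum>\<beta>\<in>UNIV. \<Sum>\<gamma>\<in>UNIV. snd z $ \<beta> * snd z $ \<gamma> * (met (Lc c) j i z * Gamma_tilde (Lc c) i \<beta> \<gamma> z))"
    by (simp add: spray_def sum_distrib_left mult_ac)
  also have "\<dots> = 1 / 2 * (\<Sum>\<beta>\<in>UNIV. \<Sum>i\<in>UNIV. \<Sum>\<gamma>\<in>UNIV. snd z $ \<beta> * snd z $ \<gamma> * (met (Lc c) j i z * Gamma_tilde (Lc c) i \<beta> \<gamma> z))"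
    by (subst sum.swap) (rule refl)
  also have "\<dots> = 1 / 2 * (\<Sum>\<beta>\<in>UNIV. \<Sum>\<gamma>\<in>UNIV. \<Sum>i\<in>UNIV. snd z $ \<beta> * snd z $ \<gamma> * (met (Lc c) j i z * Gamma_tilde (Lc c) i \<beta> \<gamma> z))"
    by (intro arg_cong[of _ _ "\<lambda>x. 1 / 2 * x"] sum.cong refl sum.swap)
  finally show ?thesis unfolding sum_distrib_left[symmetric] lower_Gamma_tilde[OF assms] .
qed

lemma lower_Gamma_chern:
  assumes "c \<in> A" "z \<in> slit c"
  shows "(\<Sum>i\<in>UNIV. met (Lc c) j i z * Gamma_chern (Lc c) i \<beta> \<gamma> z) = christoffel c z j \<beta> \<gamma> -
     1 / 2 * (\<Sum>\<mu>\<in>UNIV. dv \<mu> (met (Lc c) j \<gamma>) z * nonlin (Lc c) \<mu> \<beta> z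
        + dv \<mu> (met (Lc c) \<beta> j) z * nonlin (Lc c) \<mu> \<gamma> z - dv \<mu> (met (Lc c) \<beta> \<gamma>) z * nonlin (Lc c) \<mu> j z)"
proof -
  let ?X = "\<lambda>j. 1 / 2 * (\<Sum>\<mu>\<in>UNIV. dv \<mu> (met (Lc c) j \<gamma>) z * nonlin (Lc c) \<mu> \<beta> z
        + dv \<mu> (met (Lc c) \<beta> j) z * nonlin (Lc c) \<mu> \<gamma> z - dv \<mu> (met (Lc c) \<beta> \<gamma>) z * nonlin (Lc c) \<mu> j z)"
  have "Gamma_chern (Lc c) i \<beta> \<gamma> z = Gamma_tilde (Lc c) i \<beta> \<gamma> z - (\<Sum>\<delta>\<in>UNIV. met_inv (Lc c) i \<delta> z * ?X \<delta>)" for i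
    unfolding Gamma_chern_def by (simp add: sum_distrib_left sum_distrib_right mult_ac)
  then have "(\<Sum>i\<in>UNIV. met (Lc c) j i z * Gamma_chern (Lc c) i \<beta> \<gamma> z) =
    (\<Sum>i\<in>UNIV. met (Lc c) j i z * Gamma_tilde (Lc c) i \<beta> \<gamma> z) -
    (\<Sum>i\<in>UNIV. met (Lc c) j i z * (\<Sum>\<delta>\<in>UNIV. met_inv (Lc c) i \<delta> z * ?X \<delta>))"
    by (simp only: right_diff_distrib sum_subtractf)
  then show ?thesis unfolding lower_Gamma_tilde[OF assms] met_inv_cancel[OF assms] .
qed

text \<open>By homogeneity every derivative of the metric in the fibre direction vanishes when contracted
  with the reference vector, so only \<open>\<partial>\<^sub>\<gamma> g(v, v)\<close> survives.\<close>

lemma lower_Gamma_chern_reference: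
  assumes "c \<in> A" "z \<in> slit c"
  shows "(\<Sum>j\<in>UNIV. \<Sum>\<beta>\<in>UNIV. snd z $ j * snd z $ \<beta> *
      (\<Sum>i\<in>UNIV. met (Lc c) j i z * Gamma_chern (Lc c) i \<beta> \<gamma> z)) =
    1 / 2 * (\<Sum>j\<in>UNIV. \<Sum>\<beta>\<in>UNIV. snd z $ j * snd z $ \<beta> * dx \<gamma> (met (Lc c) \<beta> j) z)"
proof -
  let ?v = "snd z"
  define S where "S F = (\<Sum>j\<in>UNIV. \<Sum>\<beta>\<in>UNIV. ?v $ j * ?v $ \<beta> * F j \<beta>)" for F :: "'i \<Rightarrow> 'i \<Rightarrow> real"
  have S_flip: "S (\<lambda>j \<beta>. F \<beta> j) = S F" for F
    unfolding S_def by (subst sum.swap) (simp add: mult_ac)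
  have S_add: "S (\<lambda>j \<beta>. F j \<beta> + G j \<beta>) = S F + S G" for F G
    by (simp add: S_def distrib_left sum.distrib)
  have S_diff: "S (\<lambda>j \<beta>. F j \<beta> - G j \<beta>) = S F - S G" for F G
    by (simp add: S_def right_diff_distrib sum_subtractf)
  have S_scale: "S (\<lambda>j \<beta>. a * F j \<beta>) = a * S F" for F a
    by (simp add: S_def sum_distrib_left mult_ac)
  have S_zero: "S F = 0" if "\<And>\<beta>. (\<Sum>j\<in>UNIV. ?v $ j * F j \<beta>) = 0" for F
  proof -
    have "S F = (\<Sum>\<beta>\<in>UNIV. ?v $ \<beta> * (\<Sum>j\<in>UNIV. ?v $ j * F j \<beta>))"
      unfolding S_def by (subst sum.swap) (simp add: sum_distrib_left mult_ac)
    then show ?thesis using that by simp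
  qed
  have E: "(\<Sum>j\<in>UNIV. ?v $ j * (\<Sum>\<mu>\<in>UNIV. dv \<mu> (met (Lc c) j k) z * f \<mu>)) = 0" for k and f :: "'i \<Rightarrow> real"
  proof -
    have "(\<Sum>j\<in>UNIV. ?v $ j * (\<Sum>\<mu>\<in>UNIV. dv \<mu> (met (Lc c) j k) z * f \<mu>)) =
       (\<Sum>\<mu>\<in>UNIV. (\<Sum>j\<in>UNIV. ?v $ j * dv \<mu> (met (Lc c) j k) z) * f \<mu>)"
      unfolding sum_distrib_left by (subst sum.swap) (simp add: sum_distrib_left sum_distrib_right mult_ac)
    then show ?thesis using euler_dv_met[OF assms] by simp
  qed
  \<comment> \<open>The two occurrences of \<open>?a\<close> have opposite signs and exchanged
    indices, so they cancel in the symmetric contraction \<open>S\<close>; \<open>?p\<close> and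
    \<open>?q\<close> vanish by \<open>E\<close>.\<close>
  let ?a = "\<lambda>j \<beta>. dx \<beta> (met (Lc c) j \<gamma>) z"
  let ?p = "\<lambda>j \<beta>. \<Sum>\<mu>\<in>UNIV. dv \<mu> (met (Lc c) j \<gamma>) z * nonlin (Lc c) \<mu> \<beta> z"
  let ?q = "\<lambda>j \<beta>. \<Sum>\<mu>\<in>UNIV. dv \<mu> (met (Lc c) j \<beta>) z * nonlin (Lc c) \<mu> \<gamma> z"
  have "(\<Sum>i\<in>UNIV. met (Lc c) j i z * Gamma_chern (Lc c) i \<beta> \<gamma> z) =
    1 / 2 * (?a j \<beta> + dx \<gamma> (met (Lc c) \<beta> j) z - ?a \<beta> j) - 1 / 2 * (?p j \<beta> + ?q \<beta> j - ?p \<beta> j)" for j \<beta>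
    unfolding lower_Gamma_chern[OF assms] christoffel_def by (simp add: sum.distrib sum_subtractf)
  then have "S (\<lambda>j \<beta>. \<Sum>i\<in>UNIV. met (Lc c) j i z * Gamma_chern (Lc c) i \<beta> \<gamma> z) =
     1 / 2 * (S ?a + S (\<lambda>j \<beta>. dx \<gamma> (met (Lc c) \<beta> j) z) - S (\<lambda>j \<beta>. ?a \<beta> j))
     - 1 / 2 * (S ?p + S (\<lambda>j \<beta>. ?q \<beta> j) - S (\<lambda>j \<beta>. ?p \<beta> j))"
    by (simp only: S_add S_diff S_scale)
  also have "\<dots> = 1 / 2 * S (\<lambda>j \<beta>. dx \<gamma> (met (Lc c) \<beta> j) z)"
    unfolding S_flip[of ?a] S_flip[of ?p] S_flip[of ?q] S_zero[of ?p, OF E] S_zero[of ?q, OF E] by simp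
  finally show ?thesis unfolding S_def .
qed

text \<open>The right-hand side is what the product rule gives for the derivative of g_v(v, Y) along
  a curve with acceleration v' = -2 G. The identity thus says that this derivative is g_v(v, DY)
  along geodesics, but as pure algebra at one point \<open>z\<close>, with \<open>Y\<close> and
  \<open>Y'\<close> arbitrary.\<close>

lemma metric_compatibility:
  assumes cz: "c \<in> A" "z \<in> slit c"
  defines "v \<equiv> snd z"
  shows "met_form (Lc c) z v (\<chi> \<alpha>. Y' $ \<alpha> + (\<Sum>\<beta>\<in>UNIV. \<Sum>\<gamma>\<in>UNIV. Gamma_chern (Lc c) \<alpha> \<beta> \<gamma> z * v $ \<beta> * Y $ \<gamma>)) =
    (\<Sum>i\<in>UNIV. \<Sum>j\<in>UNIV.
      ((\<Sum>k\<in>UNIV. v $ k * dx k (met (Lc c) i j) z) + (\<Sum>k\<in>UNIV. (- 2 * spray (Lc c) k z) * dv k (met (Lc c) i j) z)) * v $ i * Y $ j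
      + met (Lc c) i j z * (- 2 * spray (Lc c) i z) * Y $ j + met (Lc c) i j z * v $ i * Y' $ j)"
    (is "?l = ?r")
proof -
  \<comment> \<open>\<open>K\<close> arises from differentiating the metric along v, and
    \<open>D j\<close> is the j-th base derivative of g(v, v) with v frozen. The lowered spray
    satisfies 2 G_j = K_j - D_j / 2, so the acceleration cancels \<open>K\<close> and leaves half of
    \<open>D\<close>, which is also what the connection contributes on the left.\<close>
  define D where "D j = (\<Sum>\<beta>\<in>UNIV. \<Sum>\<gamma>\<in>UNIV. v $ \<beta> * v $ \<gamma> * dx j (met (Lc c) \<beta> \<gamma>) z)" for j
  define K where "K j = (\<Sum>\<beta>\<in>UNIV. \<Sum>\<gamma>\<in>UNIV. v $ \<beta> * v $ \<gamma> * dx \<beta> (met (Lc c) \<gamma> j) z)" for j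
  let ?M = "\<Sum>i\<in>UNIV. \<Sum>j\<in>UNIV. met (Lc c) i j z * v $ i * Y' $ j"
  let ?G = "\<lambda>i j \<beta> \<gamma>. v $ i * v $ \<beta> * Y $ \<gamma> * (met (Lc c) i j z * Gamma_chern (Lc c) j \<beta> \<gamma> z)"
  have "?l = ?M + (\<Sum>i\<in>UNIV. \<Sum>j\<in>UNIV. \<Sum>\<beta>\<in>UNIV. \<Sum>\<gamma>\<in>UNIV. ?G i j \<beta> \<gamma>)"
    unfolding met_form_def by (simp add: distrib_left sum.distrib sum_distrib_left mult_ac)
  also have "(\<Sum>i\<in>UNIV. \<Sum>j\<in>UNIV. \<Sum>\<beta>\<in>UNIV. \<Sum>\<gamma>\<in>UNIV. ?G i j \<beta> \<gamma>)
      = (\<Sum>i\<in>UNIV. \<Sum>\<beta>\<in>UNIV. \<Sum>j\<in>UNIV. \<Sum>\<gamma>\<in>UNIV. ?G i j \<beta> \<gamma>)"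
    by (intro sum.cong refl sum.swap)
  also have "\<dots> = (\<Sum>i\<in>UNIV. \<Sum>\<beta>\<in>UNIV. \<Sum>\<gamma>\<in>UNIV. \<Sum>j\<in>UNIV. ?G i j \<beta> \<gamma>)"
    by (intro sum.cong refl sum.swap)
  also have "\<dots> = (\<Sum>i\<in>UNIV. \<Sum>\<gamma>\<in>UNIV. \<Sum>\<beta>\<in>UNIV. \<Sum>j\<in>UNIV. ?G i j \<beta> \<gamma>)"
    by (intro sum.cong refl sum.swap)
  also have "\<dots> = (\<Sum>\<gamma>\<in>UNIV. \<Sum>i\<in>UNIV. \<Sum>\<beta>\<in>UNIV. \<Sum>j\<in>UNIV. ?G i j \<beta> \<gamma>)"
    by (rule sum.swap)
  also have "\<dots> = (\<Sum>\<gamma>\<in>UNIV. Y $ \<gamma> * (\<Sum>i\<in>UNIV. \<Sum>\<beta>\<in>UNIV. v $ i * v $ \<beta> *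
      (\<Sum>j\<in>UNIV. met (Lc c) i j z * Gamma_chern (Lc c) j \<beta> \<gamma> z)))"
    by (simp add: sum_distrib_left mult_ac)
  also have "\<dots> = (\<Sum>\<gamma>\<in>UNIV. Y $ \<gamma> * (1 / 2 * D \<gamma>))"
    unfolding v_def lower_Gamma_chern_reference[OF cz] D_def
    by (subst (2) sum.swap) (simp add: mult_ac)
  finally have l: "?l = ?M + (\<Sum>\<gamma>\<in>UNIV. Y $ \<gamma> * (1 / 2 * D \<gamma>))" .

  \<comment> \<open>The metric also varies because its reference vector accelerates; homogeneity
    makes this contribution vanish.\<close>
  have dv0: "(\<Sum>i\<in>UNIV. \<Sum>j\<in>UNIV. (\<Sum>k\<in>UNIV. (- 2 * spray (Lc c) k z) * dv k (met (Lc c) i j) z) * v $ i * Y $ j) = 0"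
  proof -
    have "(\<Sum>i\<in>UNIV. \<Sum>j\<in>UNIV. (\<Sum>k\<in>UNIV. (- 2 * spray (Lc c) k z) * dv k (met (Lc c) i j) z) * v $ i * Y $ j)
      = (\<Sum>j\<in>UNIV. \<Sum>i\<in>UNIV. \<Sum>k\<in>UNIV. Y $ j * (- 2 * spray (Lc c) k z) * (v $ i * dv k (met (Lc c) i j) z))"
      by (subst sum.swap) (simp add: sum_distrib_left sum_distrib_right mult_ac)
    also have "\<dots> = (\<Sum>j\<in>UNIV. \<Sum>k\<in>UNIV. \<Sum>i\<in>UNIV. Y $ j * (- 2 * spray (Lc c) k z) * (v $ i * dv k (met (Lc c) i j) z))"
      by (intro sum.cong refl sum.swap)
    finally show ?thesis
      unfolding sum_distrib_left[symmetric] v_def euler_dv_met[OF cz] by simp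
  qed
  have dx: "(\<Sum>i\<in>UNIV. \<Sum>j\<in>UNIV. (\<Sum>k\<in>UNIV. v $ k * dx k (met (Lc c) i j) z) * v $ i * Y $ j) = (\<Sum>j\<in>UNIV. Y $ j * K j)"
  proof -
    have "(\<Sum>i\<in>UNIV. \<Sum>j\<in>UNIV. (\<Sum>k\<in>UNIV. v $ k * dx k (met (Lc c) i j) z) * v $ i * Y $ j)
      = (\<Sum>j\<in>UNIV. \<Sum>i\<in>UNIV. \<Sum>k\<in>UNIV. Y $ j * (v $ k * v $ i * dx k (met (Lc c) i j) z))"
      by (subst sum.swap) (simp add: sum_distrib_left sum_distrib_right mult_ac)
    also have "\<dots> = (\<Sum>j\<in>UNIV. \<Sum>k\<in>UNIV. \<Sum>i\<in>UNIV. Y $ j * (v $ k * v $ i * dx k (met (Lc c) i j) z))"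
      by (intro sum.cong refl sum.swap)
    finally show ?thesis by (simp add: K_def sum_distrib_left)
  qed
  have sp: "(\<Sum>i\<in>UNIV. met (Lc c) j i z * spray (Lc c) i z) = 1 / 2 * (K j - 1 / 2 * D j)" for j
  proof -
    have K': "(\<Sum>\<beta>\<in>UNIV. \<Sum>\<gamma>\<in>UNIV. v $ \<beta> * v $ \<gamma> * dx \<gamma> (met (Lc c) \<beta> j) z) = K j"
      unfolding K_def by (subst sum.swap) (simp add: mult_ac)
    have "(\<Sum>\<beta>\<in>UNIV. \<Sum>\<gamma>\<in>UNIV. v $ \<beta> * v $ \<gamma> * christoffel c z j \<beta> \<gamma>) =
      1 / 2 * (\<Sum>\<beta>\<in>UNIV. \<Sum>\<gamma>\<in>UNIV. v $ \<beta> * v $ \<gamma> * dx \<beta> (met (Lc c) \<gamma> j) z + v $ \<beta> * v $ \<gamma> * dx \<gamma> (met (Lc c) \<beta> j) z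
        - v $ \<beta> * v $ \<gamma> * dx j (met (Lc c) \<beta> \<gamma>) z)"
      unfolding christoffel_def dx_met_sym[OF cz, of _ j] by (simp add: sum_distrib_left algebra_simps)
    also have "\<dots> = 1 / 2 * (K j + K j - D j)"
      by (simp add: sum.distrib sum_subtractf K' D_def) (simp add: K_def)
    finally show ?thesis unfolding lower_spray[OF cz] v_def by simp
  qed
  have "(\<Sum>i\<in>UNIV. \<Sum>j\<in>UNIV. met (Lc c) i j z * (- 2 * spray (Lc c) i z) * Y $ j)
     = (\<Sum>j\<in>UNIV. Y $ j * (- 2 * (\<Sum>i\<in>UNIV. met (Lc c) j i z * spray (Lc c) i z)))"
    by (subst sum.swap) (simp add: sum_distrib_left mult_ac met_sym[OF cz, of _ "_"])
  also have "\<dots> = (\<Sum>j\<in>UNIV. Y $ j * (1 / 2 * D j - K j))"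
    unfolding sp by (simp add: algebra_simps)
  finally have met: "(\<Sum>i\<in>UNIV. \<Sum>j\<in>UNIV. met (Lc c) i j z * (- 2 * spray (Lc c) i z) * Y $ j) = \<dots>" .
  have "?r = (\<Sum>j\<in>UNIV. Y $ j * K j) + 0 + (\<Sum>j\<in>UNIV. Y $ j * (1 / 2 * D j - K j)) + ?M"
    unfolding dv0[symmetric] dx[symmetric] met[symmetric] by (simp only: sum.distrib distrib_right)
  also have "\<dots> = ?M + (\<Sum>\<gamma>\<in>UNIV. Y $ \<gamma> * (1 / 2 * D \<gamma>))"
    by (simp add: right_diff_distrib sum_subtractf)
  finally show ?thesis using l by simp
qed

end

section \<open>Normal fields along a timelike geodesic\<close>

lemma smooth_on_transition:
  "smooth_atlas A \<Longrightarrow> c \<in> A \<Longrightarrow> d \<in> A \<Longrightarrow> smooth_on (snd c ` (fst c \<inter> fst d)) (transition c d)"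
  unfolding smooth_atlas_def by blast

lemma tscale_apply: "tscale a v c = a *\<^sub>R v c"
  by (simp add: tscale_def)

lemma tscale_zero_left: "tscale 0 v = 0"
  by (simp add: tscale_def fun_eq_iff)

lemma tscale_one: "tscale 1 v = v"
  by (simp add: tscale_def)

lemma tscale_tscale: "tscale a (tscale b v) = tscale (a * b) v"
  by (simp add: tscale_def)

lemma tscale_add_right: "tscale a (u + v) = tscale a u + tscale a v"
  by (simp add: tscale_def fun_eq_iff scaleR_add_right)

lemma endomorphismD:
  assumes "endomorphism N E"
  shows "w \<in> N \<Longrightarrow> E w \<in> N" "u \<in> N \<Longrightarrow> w \<in> N \<Longrightarrow> E (u + w) = E u + E w"
    "w \<in> N \<Longrightarrow> E (tscale a w) = tscale a (E w)"
  using assms unfolding endomorphism_def by blast+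

lemma endomorphism_compose:
  "endomorphism N E \<Longrightarrow> endomorphism N F \<Longrightarrow> endomorphism N (\<lambda>w. E (F w))"
  unfolding endomorphism_def by auto

lemma endomorphism_ident: "endomorphism N (\<lambda>w. w)"
  unfolding endomorphism_def by auto

lemma tscale_minus_one: "tscale (- 1) w = - w"
  by (simp add: tscale_def fun_eq_iff)

lemma differentiable_cong_within:
  assumes "f differentiable (at t within I)" "openin (top_of_set I) S" "t \<in> S" "\<And>s. s \<in> S \<Longrightarrow> g s = f s"
  shows "g differentiable (at t within I)" "vector_derivative g (at t within I) = vector_derivative f (at t within I)"
proof -
  obtain U where U: "open U" "S = I \<inter> U" using assms(2) openin_open by metis
  have ev: "eventually (\<lambda>s. g s = f s) (at t within I)"
    using U assms(3,4) by (auto simp: eventually_at_topological)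
  then have ev': "eventually (\<lambda>s. f s = g s) (at t within I)" by (simp add: eq_commute)
  have t: "t \<in> I" "g t = f t" using assms(3,4) U by auto
  have iff: "(g has_vector_derivative D) (at t within I) \<longleftrightarrow> (f has_vector_derivative D) (at t within I)" for D
    unfolding has_vector_derivative_def
    using has_derivative_transform_eventually[OF _ ev] has_derivative_transform_eventually[OF _ ev'] t by metis
  show "vector_derivative g (at t within I) = vector_derivative f (at t within I)"
    unfolding vector_derivative_def iff ..
  show "g differentiable (at t within I)"
    using assms(1) iff by (metis differentiableI_vector vector_derivative_works)
qed

lemma has_vector_derivative_eq_0:
  assumes "(h has_vector_derivative d) (at t within I)" "openin (top_of_set I) S" "t \<in> S"
    "\<And>s. s \<in> S \<Longrightarrow> h s = 0" "at t within I \<noteq> bot"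
  shows "d = 0"
proof -
  have "((\<lambda>_. 0) has_vector_derivative 0) (at t within I)" by (rule has_vector_derivative_const)
  moreover have "vector_derivative h (at t within I) = vector_derivative (\<lambda>_. 0) (at t within I)"
    by (rule differentiable_cong_within(2)[OF _ assms(2,3)]) (simp_all add: assms(4))
  ultimately show ?thesis
    using vector_derivative_within[OF assms(5)] assms(1) by metis
qed

locale timelike_geodesic = lorentz_finsler_manifold A L
  for A :: "('m::{t2_space, second_countable_topology}, 'i::finite) chart set"
    and L :: "'m \<Rightarrow> ('m, 'i) tvec \<Rightarrow> real" +
  fixes X :: "'m \<Rightarrow> ('m, 'i) tvec" and \<eta> :: "real \<Rightarrow> 'm" and I :: "real set"
  assumes geodesic: "unit_timelike_geodesic A L X \<eta> I"
begin

abbreviation dom :: "('m, 'i) chart \<Rightarrow> real set" where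
  "dom c \<equiv> {s \<in> I. \<eta> s \<in> fst c}"

abbreviation vel :: "real \<Rightarrow> ('m, 'i) tvec" where
  "vel \<equiv> velocity A \<eta> I"

abbreviation lift :: "('m, 'i) chart \<Rightarrow> real \<Rightarrow> (real ^ 'i) \<times> (real ^ 'i)" where
  "lift \<equiv> velocity_at A \<eta> I"

abbreviation Nor :: "real \<Rightarrow> ('m, 'i) tvec set" where
  "Nor \<equiv> normal_complement A L \<eta> I"

abbreviation g :: "('m, 'i) chart \<Rightarrow> real \<Rightarrow> real ^ 'i \<Rightarrow> real ^ 'i \<Rightarrow> real" where
  "g c s \<equiv> met_form (Lc c) (lift c s)"

abbreviation nearby :: "real set \<Rightarrow> bool" where
  "nearby S \<equiv> openin (top_of_set I) S"

abbreviation cov :: "('m, 'i) chart \<Rightarrow> (real \<Rightarrow> ('m, 'i) tvec) \<Rightarrow> real \<Rightarrow> ('m, 'i) tvec" where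
  "cov \<equiv> cov_deriv A L \<eta> I"

lemma at_within_I: "t \<in> I \<Longrightarrow> at t within I \<noteq> bot"
  using geodesic interval_at_within_ne_bot unfolding unit_timelike_geodesic_def by metis

lemma open_dom: "c \<in> A \<Longrightarrow> nearby (dom c)"
proof -
  assume c: "c \<in> A"
  have "continuous_on I \<eta>"
    using geodesic unfolding unit_timelike_geodesic_def smooth_manifold_curve_def by blast
  from continuous_openin_preimage_gen[OF this open_chart[OF c]]
  show ?thesis by (simp add: vimage_def Int_def)
qed

lemma nearby_subset: "nearby S \<Longrightarrow> S \<subseteq> I"
  by (rule openin_imp_subset)

lemma vel_future: "s \<in> I \<Longrightarrow> vel s \<in> future_timelike A L X (\<eta> s)"
  using geodesic unfolding unit_timelike_geodesic_def by blast

lemma vel_tangent: "s \<in> I \<Longrightarrow> vel s \<in> tangent_space A (\<eta> s)"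
  using vel_future unfolding future_timelike_def timelike_vectors_def by blast

lemma L_vel: "s \<in> I \<Longrightarrow> L (\<eta> s) (vel s) = - 1 / 2"
proof -
  assume "s \<in> I"
  then have "sqrt (- 2 * L (\<eta> s) (vel s)) = 1"
    using geodesic unfolding unit_timelike_geodesic_def by blast
  then show ?thesis by (simp add: real_sqrt_eq_1_iff)
qed

lemma Lc_lift: "c \<in> A \<Longrightarrow> s \<in> dom c \<Longrightarrow> Lc c (lift c s) = - 1 / 2"
  by (simp add: Lc_apply tvec_of_tangent vel_tangent L_vel)

text \<open>Smoothness and nondegeneracy are available only off the zero section. Homogeneity with
  the factor 2 forces L = 0 at the zero vector, whereas L = -1/2 on the velocity.\<close>

lemma lift_in_slit:
  assumes "c \<in> A" "s \<in> dom c"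
  shows "lift c s \<in> slit c"
proof -
  have "vel s c \<noteq> 0"
  proof
    assume "vel s c = 0"
    then have "Lc c (snd c (\<eta> s), 0) = - 1 / 2" using Lc_lift[OF assms] by simp
    moreover have "Lc c (snd c (\<eta> s), 0) = 2\<^sup>2 * Lc c (snd c (\<eta> s), 0)"
      using Lc_homogeneous[of c "\<eta> s" 2 0] assms by simp
    ultimately show False by simp
  qed
  then show ?thesis using assms by auto
qed

lemma smooth_coordinates: "c \<in> A \<Longrightarrow> smooth_curve_on (dom c) (\<lambda>s. snd c (\<eta> s))"
  using geodesic unfolding unit_timelike_geodesic_def smooth_manifold_curve_def comp_def by blast

lemma vel_eq: "c \<in> A \<Longrightarrow> s \<in> dom c \<Longrightarrow> vel s c = vector_derivative (\<lambda>s. snd c (\<eta> s)) (at s within I)"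
  by (simp add: velocity_def comp_def)

lemma smooth_vel: "c \<in> A \<Longrightarrow> smooth_curve_on (dom c) (\<lambda>s. vel s c)"
  by (rule smooth_curve_on_cong[OF smooth_curve_on_vector_derivative[OF smooth_coordinates open_dom at_within_I]])
    (auto simp: vel_eq)

lemma smooth_lift: "c \<in> A \<Longrightarrow> smooth_curve_on (dom c) (lift c)"
  by (intro smooth_curve_on_Pair smooth_coordinates smooth_vel)

text \<open>The geodesic equation as a first-order system: the lift to the tangent bundle is an
  integral curve of the geodesic spray.\<close>

lemma lift_has_vector_derivative:
  assumes "c \<in> A" "t \<in> dom c"
  shows "(lift c has_vector_derivative (vel t c, \<chi> i. - 2 * spray (Lc c) i (lift c t))) (at t within I)"
proof -
  have 1: "((\<lambda>s. snd c (\<eta> s)) has_vector_derivative vel t c) (at t within I)"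
    using smooth_curve_on_has_vector_derivative[OF smooth_coordinates open_dom] assms by (simp add: vel_eq)
  have "vector_derivative (\<lambda>s. vel s c) (at t within I) $ i + 2 * spray (Lc c) i (lift c t) = 0" for i
    using geodesic assms unfolding unit_timelike_geodesic_def by blast
  then have "vector_derivative (\<lambda>s. vel s c) (at t within I) = (\<chi> i. - 2 * spray (Lc c) i (lift c t))"
    by (simp add: vec_eq_iff eq_neg_iff_add_eq_0)
  then have 2: "((\<lambda>s. vel s c) has_vector_derivative (\<chi> i. - 2 * spray (Lc c) i (lift c t))) (at t within I)"
    using smooth_curve_on_has_vector_derivative[OF smooth_vel[OF assms(1)] open_dom[OF assms(1)] assms(2)] by simp
  show ?thesis using has_vector_derivative_Pair[OF 1 2] .
qed

lemma has_real_derivative_along_lift: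
  assumes "c \<in> A" "t \<in> dom c" "f differentiable (at (lift c t))"
  shows "((\<lambda>s. f (lift c s)) has_real_derivative
    (\<Sum>k\<in>UNIV. vel t c $ k * dx k f (lift c t)) + (\<Sum>k\<in>UNIV. (- 2 * spray (Lc c) k (lift c t)) * dv k f (lift c t))) (at t within I)"
proof -
  let ?D = "frechet_derivative f (at (lift c t))" and ?w = "(vel t c, \<chi> i. - 2 * spray (Lc c) i (lift c t))"
  have "((\<lambda>s. f (lift c s)) has_derivative (\<lambda>r. ?D (r *\<^sub>R ?w))) (at t within I)"
    using has_derivative_compose[OF lift_has_vector_derivative[OF assms(1,2), unfolded has_vector_derivative_def]
      assms(3)[unfolded frechet_derivative_works]] .
  moreover have "?D (r *\<^sub>R ?w) = r * ?D ?w" for r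
    by (simp only: linear_cmul[OF linear_frechet_derivative[OF assms(3)]] real_scaleR_def)
  ultimately have "((\<lambda>s. f (lift c s)) has_real_derivative ?D ?w) (at t within I)"
    by (simp add: has_field_derivative_def mult_commute_abs)
  then show ?thesis using frechet_derivative_dx_dv[OF assms(3), of "fst ?w" "snd ?w"] by simp
qed

lemma g_vel_vel: "c \<in> A \<Longrightarrow> s \<in> dom c \<Longrightarrow> g c s (vel s c) (vel s c) = - 1"
  using met_form_self[OF _ lift_in_slit] Lc_lift by simp

text \<open>\<open>normal_complement\<close> quantifies over all charts; the tensoriality in
  \<open>met_form_transform\<close> lets any single chart decide.\<close>

lemma normal_complement_iff:
  assumes "c \<in> A" "s \<in> dom c"
  shows "w \<in> Nor s \<longleftrightarrow> w \<in> tangent_space A (\<eta> s) \<and> g c s (vel s c) (w c) = 0"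
proof -
  have "g d s (vel s d) (w d) = 0"
    if "w \<in> tangent_space A (\<eta> s)" "g c s (vel s c) (w c) = 0" "d \<in> A" "\<eta> s \<in> fst d" for d
  proof -
    have "vel s c \<noteq> 0" using lift_in_slit[OF assms] by simp
    from met_form_transform[OF assms(1) that(3) _ that(4) this, of "vel s c" "w c"] show ?thesis
      using that assms tangent_space_trans_deriv[OF vel_tangent, of s c d] tangent_space_trans_deriv[OF that(1), of c d]
      by simp
  qed
  then show ?thesis using assms unfolding normal_complement_def by blast
qed

lemma normal_complement_tangent: "w \<in> Nor s \<Longrightarrow> w \<in> tangent_space A (\<eta> s)"
  unfolding normal_complement_def by blast

lemma ex_dom: "s \<in> I \<Longrightarrow> \<exists>c\<in>A. s \<in> dom c"
  using ex_chart by simp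

lemma Nor_add:
  assumes "s \<in> I" "u \<in> Nor s" "w \<in> Nor s"
  shows "u + w \<in> Nor s"
proof -
  obtain c where c: "c \<in> A" "s \<in> dom c" using ex_dom assms(1) by blast
  show ?thesis using assms unfolding normal_complement_iff[OF c]
    by (simp add: tangent_space_add met_form_add_right)
qed

lemma Nor_tscale:
  assumes "s \<in> I" "w \<in> Nor s"
  shows "tscale a w \<in> Nor s"
proof -
  obtain c where c: "c \<in> A" "s \<in> dom c" using ex_dom assms(1) by blast
  show ?thesis using assms unfolding normal_complement_iff[OF c]
    by (simp add: tangent_space_tscale met_form_scale_right tscale_apply)
qed

lemma Nor_zero:
  assumes "s \<in> I"
  shows "0 \<in> Nor s"
proof -
  obtain c where c: "c \<in> A" "s \<in> dom c" using ex_dom assms(1) by blast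
  have "tscale 0 (vel s) \<in> tangent_space A (\<eta> s)"
    using assms by (intro tangent_space_tscale vel_tangent)
  then show ?thesis unfolding normal_complement_iff[OF c]
    by (simp add: tscale_zero_left met_form_zero_right)
qed

lemma Nor_diff: "s \<in> I \<Longrightarrow> u \<in> Nor s \<Longrightarrow> w \<in> Nor s \<Longrightarrow> u - w \<in> Nor s"
  using Nor_add[of s u "tscale (- 1) w"] Nor_tscale[of s w "- 1"]
  by (simp add: tscale_def fun_diff_def plus_fun_def)

text \<open>The g-orthogonal projection along the velocity, in coordinates; the sign is plus because
  g(v, v) = -1.\<close>

definition proj :: "('m, 'i) chart \<Rightarrow> real \<Rightarrow> real ^ 'i \<Rightarrow> real ^ 'i" where
  "proj c s u = u + g c s (vel s c) u *\<^sub>R vel s c"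

lemma g_vel_proj: "c \<in> A \<Longrightarrow> s \<in> dom c \<Longrightarrow> g c s (vel s c) (proj c s u) = 0"
  unfolding proj_def met_form_add_right met_form_scale_right by (subst g_vel_vel) auto

lemma linear_proj: "linear (proj c s)"
  by (intro linearI) (simp_all add: proj_def met_form_add_right met_form_scale_right algebra_simps)

lemma proj_normal: "c \<in> A \<Longrightarrow> s \<in> dom c \<Longrightarrow> w \<in> Nor s \<Longrightarrow> proj c s (w c) = w c"
  by (simp add: proj_def normal_complement_iff)

lemma tvec_of_normal:
  "c \<in> A \<Longrightarrow> s \<in> dom c \<Longrightarrow> g c s (vel s c) u = 0 \<Longrightarrow> tvec_of A c (\<eta> s) u \<in> Nor s"
  by (simp add: normal_complement_iff tvec_of_in_tangent_space tvec_of_apply_same)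

text \<open>One chart suffices: in another chart the components are combinations of those in
  \<open>c\<close>, with coefficients given by transition derivatives along the smooth coordinate
  curve.\<close>

lemma smooth_normal_fieldI:
  assumes c: "c \<in> A" "S \<subseteq> dom c" and P: "\<And>s. s \<in> S \<Longrightarrow> P s \<in> Nor s" "smooth_curve_on S (\<lambda>s. P s c)"
  shows "smooth_normal_field A L \<eta> I S P"
  unfolding smooth_normal_field_def
proof (intro conjI ballI)
  fix d assume d: "d \<in> A"
  let ?S = "{s \<in> S. \<eta> s \<in> fst d}"
  let ?W = "snd c ` (fst c \<inter> fst d)"
  have "smooth_curve_on ?S (\<lambda>s. \<Sum>i\<in>UNIV. P s c $ i *\<^sub>R frechet_derivative (transition c d) (at (snd c (\<eta> s))) (axis i 1))"
  proof (intro smooth_curve_on_sum smooth_curve_on_scaleR smooth_curve_on_component)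
    show "smooth_curve_on ?S (\<lambda>s. P s c)" using P(2) by (rule smooth_curve_on_subset) auto
    show "smooth_curve_on ?S (\<lambda>s. frechet_derivative (transition c d) (at (snd c (\<eta> s))) (axis i 1))" for i
    proof (rule smooth_curve_on_compose[where h = "\<lambda>p. frechet_derivative (transition c d) (at p) (axis i 1)"])
      show "smooth_on ?W (\<lambda>p. frechet_derivative (transition c d) (at p) (axis i 1))"
        using smooth_on_transition[OF atlas c(1) d] by (rule smooth_on_frechet_derivative)
      show "smooth_curve_on ?S (\<lambda>s. snd c (\<eta> s))"
        using smooth_coordinates[OF c(1)] by (rule smooth_curve_on_subset) (use c in auto)
    qed (use c in auto)
  qed
  then show "smooth_curve_on ?S (\<lambda>s. P s d)"
  proof (rule smooth_curve_on_cong)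
    fix s assume s: "s \<in> ?S"
    have "P s d = trans_deriv c d (\<eta> s) (P s c)"
      using s c d P(1) by (intro tangent_space_trans_deriv normal_complement_tangent) auto
    also have "\<dots> = (\<Sum>i\<in>UNIV. P s c $ i *\<^sub>R trans_deriv c d (\<eta> s) (axis i 1))"
      using s c d by (intro vec_as_sum_axis_linear linear_trans_deriv) auto
    finally show "P s d = \<dots>" .
  qed
qed (use P in auto)

lemma smooth_normal_fieldD:
  assumes "smooth_normal_field A L \<eta> I S P"
  shows "s \<in> S \<Longrightarrow> P s \<in> Nor s" "c \<in> A \<Longrightarrow> smooth_curve_on {s \<in> S. \<eta> s \<in> fst c} (\<lambda>s. P s c)"
  using assms unfolding smooth_normal_field_def by blast+

lemma smooth_normal_field_subset:
  "smooth_normal_field A L \<eta> I S P \<Longrightarrow> S' \<subseteq> S \<Longrightarrow> smooth_normal_field A L \<eta> I S' P"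
  unfolding smooth_normal_field_def by (blast intro: smooth_curve_on_subset)

lemma smooth_normal_field_differentiable:
  assumes "smooth_normal_field A L \<eta> I S P" "nearby S" "t \<in> S" "c \<in> A" "\<eta> t \<in> fst c"
  shows "(\<lambda>s. P s c) differentiable (at t within I)"
proof -
  have "nearby (S \<inter> dom c)" using assms open_dom by (intro openin_Int) auto
  moreover have "S \<inter> dom c = {s \<in> S. \<eta> s \<in> fst c}" using nearby_subset[OF assms(2)] by auto
  ultimately show ?thesis
    using smooth_curve_on_has_vector_derivative[OF smooth_normal_fieldD(2)[OF assms(1,4)], of I t] assms
      differentiableI_vector by fastforce
qed

lemma smooth_met: "c \<in> A \<Longrightarrow> smooth_curve_on (dom c) (\<lambda>s. met (Lc c) i j (lift c s))"
  by (rule smooth_curve_on_compose[OF met_smooth smooth_lift]) (auto dest: lift_in_slit)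

lemma smooth_proj:
  assumes c: "c \<in> A"
  shows "smooth_curve_on (dom c) (\<lambda>s. proj c s u)"
  unfolding proj_def met_form_def
  by (intro smooth_curve_on_add smooth_curve_on_const smooth_curve_on_scaleR smooth_curve_on_sum
      smooth_curve_on_mult smooth_met smooth_curve_on_component smooth_vel c)

lemma smooth_normal_field_proj:
  assumes c: "c \<in> A"
  shows "smooth_normal_field A L \<eta> I (dom c) (\<lambda>s. tvec_of A c (\<eta> s) (proj c s u))"
proof (rule smooth_normal_fieldI[OF c order_refl])
  show "smooth_curve_on (dom c) (\<lambda>s. tvec_of A c (\<eta> s) (proj c s u) c)"
    by (rule smooth_curve_on_cong[OF smooth_proj[OF c]]) (simp add: c tvec_of_apply_same)
qed (use c in \<open>auto intro!: tvec_of_normal g_vel_proj\<close>)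

text \<open>The components of \<open>w\<close> are kept constant in one chart and projected at each
  time; the projection varies smoothly and fixes \<open>w\<close> at time \<open>t\<close>.\<close>

lemma ex_smooth_normal_extension:
  assumes "t \<in> I" "w \<in> Nor t"
  shows "\<exists>S P. nearby S \<and> t \<in> S \<and> smooth_normal_field A L \<eta> I S P \<and> P t = w"
proof -
  obtain c where c: "c \<in> A" "t \<in> dom c" using ex_dom assms(1) by blast
  have "tvec_of A c (\<eta> t) (proj c t (w c)) = w"
    using c assms by (simp add: proj_normal tvec_of_tangent normal_complement_tangent)
  then show ?thesis using c open_dom smooth_normal_field_proj by blast
qed

section \<open>The covariant derivative and its product rules\<close>

lemma cov_tangent: "c \<in> A \<Longrightarrow> t \<in> dom c \<Longrightarrow> cov c Y t \<in> tangent_space A (\<eta> t)"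
  by (simp add: cov_deriv_def tvec_of_in_tangent_space)

lemma cov_apply:
  "c \<in> A \<Longrightarrow> t \<in> dom c \<Longrightarrow> cov c Y t c = (\<chi> \<alpha>. vector_derivative (\<lambda>s. Y s c) (at t within I) $ \<alpha> +
        (\<Sum>\<beta>\<in>UNIV. \<Sum>\<gamma>\<in>UNIV. Gamma_chern (Lc c) \<alpha> \<beta> \<gamma> (lift c t) * vel t c $ \<beta> * Y t c $ \<gamma>))"
  by (simp add: cov_deriv_def tvec_of_apply_same)

lemma cov_cong:
  assumes "(\<lambda>s. Y s c) differentiable (at t within I)" "nearby S" "t \<in> S" "\<And>s. s \<in> S \<Longrightarrow> Z s = Y s"
  shows "cov c Z t = cov c Y t"
  using differentiable_cong_within(2)[OF assms(1-3), of "\<lambda>s. Z s c"] assms(3,4)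
  by (simp add: cov_deriv_def)

text \<open>The function g(v, Y) is zero on a relative neighbourhood of \<open>t\<close>, hence so
  is its derivative at \<open>t\<close>, and \<open>metric_compatibility\<close> identifies that
  derivative with g(v, DY).\<close>

lemma cov_normal:
  assumes c: "c \<in> A" "t \<in> dom c" and S: "nearby S" "t \<in> S" "\<And>s. s \<in> S \<Longrightarrow> Y s \<in> Nor s"
    and Y: "(\<lambda>s. Y s c) differentiable (at t within I)"
  shows "cov c Y t \<in> Nor t"
proof -
  define Y' where "Y' = vector_derivative (\<lambda>s. Y s c) (at t within I)"
  let ?h = "\<lambda>s. \<Sum>i\<in>UNIV. \<Sum>j\<in>UNIV. met (Lc c) i j (lift c s) * vel s c $ i * Y s c $ j"
  let ?a = "\<lambda>i. - 2 * spray (Lc c) i (lift c t)"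
  let ?m = "\<lambda>i j. (\<Sum>k\<in>UNIV. vel t c $ k * dx k (met (Lc c) i j) (lift c t))
    + (\<Sum>k\<in>UNIV. ?a k * dv k (met (Lc c) i j) (lift c t))"
  have z: "lift c t \<in> slit c" using lift_in_slit c by blast
  have met: "((\<lambda>s. met (Lc c) i j (lift c s)) has_real_derivative ?m i j) (at t within I)" for i j
    using has_real_derivative_along_lift[OF c smooth_on_differentiable[OF met_smooth[OF c(1)] z]] .
  have v: "((\<lambda>s. vel s c $ i) has_real_derivative ?a i) (at t within I)" for i
    using bounded_linear.has_vector_derivative[OF bounded_linear_compose[OF bounded_linear_vec_nth bounded_linear_snd]
        lift_has_vector_derivative[OF c], of i]
    by (simp add: has_real_derivative_iff_has_vector_derivative)
  have y: "((\<lambda>s. Y s c $ j) has_real_derivative Y' $ j) (at t within I)" for j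
    using bounded_linear.has_vector_derivative[OF bounded_linear_vec_nth Y[unfolded vector_derivative_works], of j]
    by (simp add: has_real_derivative_iff_has_vector_derivative Y'_def)
  \<comment> \<open>This is the right-hand side of \<open>metric_compatibility\<close>, term by
    term.\<close>
  let ?d = "\<Sum>i\<in>UNIV. \<Sum>j\<in>UNIV. ?m i j * vel t c $ i * Y t c $ j
      + met (Lc c) i j (lift c t) * ?a i * Y t c $ j + met (Lc c) i j (lift c t) * vel t c $ i * Y' $ j"
  have "(?h has_real_derivative ?d) (at t within I)"
  proof (intro DERIV_sum)
    have eq: "(p * b + q * d) * e + r * (d * b) = p * b * e + d * q * e + d * b * r" for p b q d e r :: real
      by algebra
    show "((\<lambda>s. met (Lc c) i j (lift c s) * vel s c $ i * Y s c $ j) has_real_derivative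
      ?m i j * vel t c $ i * Y t c $ j + met (Lc c) i j (lift c t) * ?a i * Y t c $ j
      + met (Lc c) i j (lift c t) * vel t c $ i * Y' $ j) (at t within I)" for i j
      by (rule DERIV_cong[OF DERIV_mult[OF DERIV_mult[OF met v] y] eq])
  qed
  then have d: "(?h has_vector_derivative ?d) (at t within I)"
    by (simp only: has_real_derivative_iff_has_vector_derivative)
  have "?h s = 0" if "s \<in> S \<inter> dom c" for s
  proof -
    have "?h s = g c s (vel s c) (Y s c)" unfolding met_form_def ..
    also have "\<dots> = 0" using that S(3) normal_complement_iff[of c s "Y s"] c(1) by blast
    finally show ?thesis .
  qed
  from has_vector_derivative_eq_0[OF d openin_Int[OF S(1) open_dom[OF c(1)]] _ this] have "?d = 0"
    using at_within_I S(2) c(2) by blast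
  then have "g c t (vel t c) (cov c Y t c) = 0"
    unfolding cov_apply[OF c] Y'_def[symmetric] using metric_compatibility[OF c(1) z, of Y' "Y t c"] by simp
  then show ?thesis unfolding normal_complement_iff[OF c] using cov_tangent[OF c] by blast
qed

lemma cov_add:
  assumes c: "c \<in> A" "t \<in> dom c"
    and Y: "(\<lambda>s. Y s c) differentiable (at t within I)" and Z: "(\<lambda>s. Z s c) differentiable (at t within I)"
  shows "cov c (\<lambda>s. Y s + Z s) t = cov c Y t + cov c Z t"
proof -
  have "vector_derivative (\<lambda>s. (Y s + Z s) c) (at t within I) =
      vector_derivative (\<lambda>s. Y s c) (at t within I) + vector_derivative (\<lambda>s. Z s c) (at t within I)"
    using Y Z at_within_I c
    by (auto intro!: vector_derivative_within has_vector_derivative_add simp: vector_derivative_works)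
  then have "cov c (\<lambda>s. Y s + Z s) t c = (cov c Y t + cov c Z t) c"
    unfolding plus_fun_apply cov_apply[OF c]
    by (simp add: vec_eq_iff distrib_left sum.distrib)
  then show ?thesis
    using c by (intro tangent_space_eqI[of _ "\<eta> t" _ c] tangent_space_add cov_tangent[OF c]) simp_all
qed

lemma cov_tscale:
  assumes c: "c \<in> A" "t \<in> dom c" and Y: "(\<lambda>s. Y s c) differentiable (at t within I)" "Y t \<in> tangent_space A (\<eta> t)"
    and h: "(h has_vector_derivative h') (at t within I)"
  shows "cov c (\<lambda>s. tscale (h s) (Y s)) t = tscale (h t) (cov c Y t) + tscale h' (Y t)"
proof -
  have "vector_derivative (\<lambda>s. tscale (h s) (Y s) c) (at t within I) =
      h t *\<^sub>R vector_derivative (\<lambda>s. Y s c) (at t within I) + h' *\<^sub>R Y t c"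
    unfolding tscale_apply using Y h at_within_I c
    by (auto intro!: vector_derivative_within bounded_bilinear.has_vector_derivative[OF bounded_bilinear_scaleR]
        simp: vector_derivative_works)
  then have "cov c (\<lambda>s. tscale (h s) (Y s)) t c = (tscale (h t) (cov c Y t) + tscale h' (Y t)) c"
    unfolding plus_fun_apply tscale_apply cov_apply[OF c]
    by (simp add: vec_eq_iff distrib_left sum_distrib_left mult_ac)
  then show ?thesis using c Y
    by (intro tangent_space_eqI[of _ "\<eta> t" _ c] tangent_space_add tangent_space_tscale cov_tangent[OF c]) simp_all
qed

end

section \<open>Covariant derivatives of endomorphism fields\<close>

context timelike_geodesic
begin

abbreviation has_deriv :: "(real \<Rightarrow> ('m, 'i) tvec \<Rightarrow> ('m, 'i) tvec) \<Rightarrow> (('m, 'i) tvec \<Rightarrow> ('m, 'i) tvec) \<Rightarrow> real \<Rightarrow> bool" where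
  "has_deriv \<equiv> has_endo_deriv A L \<eta> I"

lemma has_derivI:
  assumes "endomorphism (Nor t) E'"
    "\<And>S P c. nearby S \<Longrightarrow> t \<in> S \<Longrightarrow> smooth_normal_field A L \<eta> I S P \<Longrightarrow> c \<in> A \<Longrightarrow> t \<in> dom c \<Longrightarrow>
      (\<lambda>s. E s (P s) c) differentiable (at t within I) \<and> E' (P t) = cov c (\<lambda>s. E s (P s)) t - E t (cov c P t)"
  shows "has_deriv E E' t"
  unfolding has_endo_deriv_def
proof (intro conjI allI impI ballI assms(1))
  fix S P c assume "nearby S \<and> t \<in> S \<and> smooth_normal_field A L \<eta> I S P" "c \<in> A" "\<eta> t \<in> fst c"
  with assms(2)[of S P c] nearby_subset[of S]
  show "(\<lambda>s. E s (P s) c) differentiable (at t within I)" "E' (P t) = cov c (\<lambda>s. E s (P s)) t - E t (cov c P t)"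
    by blast+
qed

lemma has_derivD:
  assumes "has_deriv E E' t"
  shows "endomorphism (Nor t) E'"
    "nearby S \<Longrightarrow> t \<in> S \<Longrightarrow> smooth_normal_field A L \<eta> I S P \<Longrightarrow> c \<in> A \<Longrightarrow> t \<in> dom c \<Longrightarrow>
      (\<lambda>s. E s (P s) c) differentiable (at t within I)"
    "nearby S \<Longrightarrow> t \<in> S \<Longrightarrow> smooth_normal_field A L \<eta> I S P \<Longrightarrow> c \<in> A \<Longrightarrow> t \<in> dom c \<Longrightarrow>
      E' (P t) = cov c (\<lambda>s. E s (P s)) t - E t (cov c P t)"
  using assms unfolding has_endo_deriv_def by blast+

text \<open>Once a normal vector is extended to a smooth normal field, both candidates are given by
  the same formula on it. This turns the choice in \<open>endo_deriv\<close> into something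
  computable.\<close>

lemma has_deriv_unique:
  assumes "has_deriv E E1 t" "has_deriv E E2 t" "t \<in> I" "w \<in> Nor t"
  shows "E1 w = E2 w"
proof -
  obtain S P where P: "nearby S" "t \<in> S" "smooth_normal_field A L \<eta> I S P" and w: "P t = w"
    using ex_smooth_normal_extension assms by blast
  obtain c where c: "c \<in> A" "t \<in> dom c" using ex_dom assms(3) by blast
  show ?thesis
    using has_derivD(3)[OF assms(1) P c] has_derivD(3)[OF assms(2) P c] w by simp
qed

lemma endo_deriv_eq:
  assumes "has_deriv E E' t" "t \<in> I" "w \<in> Nor t"
  shows "endo_deriv A L \<eta> I E t w = E' w"
  unfolding endo_deriv_def
  by (rule has_deriv_unique[OF someI[of "\<lambda>E'. has_deriv E E' t", OF assms(1)] assms])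

lemma cov_smooth_normal_field:
  assumes "nearby S" "t \<in> S" "smooth_normal_field A L \<eta> I S P" "c \<in> A" "t \<in> dom c"
  shows "cov c P t \<in> Nor t"
  using assms smooth_normal_fieldD(1) smooth_normal_field_differentiable
  by (intro cov_normal[of c t S]) auto

text \<open>Values off the normal spaces do not matter, because a test field and its covariant
  derivative are both normal. The lemma serves to pass from a closed formula to
  \<open>B_endo\<close>, which agrees with it only near \<open>t\<close> and on normal
  vectors.\<close>

lemma has_deriv_cong:
  assumes E: "has_deriv E E' t" and S0: "nearby S0" "t \<in> S0" "\<And>s w. s \<in> S0 \<Longrightarrow> w \<in> Nor s \<Longrightarrow> F s w = E s w"
  shows "has_deriv F E' t"
proof (rule has_derivI)
  fix S P c assume P: "nearby S" "t \<in> S" "smooth_normal_field A L \<eta> I S P" and c: "c \<in> A" "t \<in> dom c"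
  have S: "nearby (S0 \<inter> S)" "t \<in> S0 \<inter> S" using S0 P by (auto intro: openin_Int)
  have eq: "F s (P s) = E s (P s)" if "s \<in> S0 \<inter> S" for s
    using that S0(3) smooth_normal_fieldD(1)[OF P(3)] by blast
  have d: "(\<lambda>s. E s (P s) c) differentiable (at t within I)" using has_derivD(2)[OF E P c] .
  have "(\<lambda>s. F s (P s) c) differentiable (at t within I)"
    using eq by (intro differentiable_cong_within(1)[OF d S]) simp
  moreover have "cov c (\<lambda>s. F s (P s)) t = cov c (\<lambda>s. E s (P s)) t"
    using cov_cong[of "\<lambda>s. E s (P s)", OF d S eq] .
  moreover have "F t (cov c P t) = E t (cov c P t)"
    using S0 cov_smooth_normal_field[OF P c] by blast
  ultimately show "(\<lambda>s. F s (P s) c) differentiable (at t within I) \<and>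
      E' (P t) = cov c (\<lambda>s. F s (P s)) t - F t (cov c P t)"
    using has_derivD(3)[OF E P c] by simp
qed (rule has_derivD(1)[OF E])

section \<open>Algebra of endomorphism fields, product rules and smooth inversion\<close>

lemma endomorphism_add:
  assumes "endomorphism (Nor t) E" "endomorphism (Nor t) F" "t \<in> I"
  shows "endomorphism (Nor t) (\<lambda>w. E w + F w)"
  unfolding endomorphism_def using endomorphismD[OF assms(1)] endomorphismD[OF assms(2)] assms(3)
  by (auto intro: Nor_add simp: tscale_add_right add_ac)

lemma endomorphism_tscale:
  assumes "endomorphism (Nor t) E" "t \<in> I"
  shows "endomorphism (Nor t) (\<lambda>w. tscale a (E w))"
  unfolding endomorphism_def using endomorphismD[OF assms(1)] assms(2)
  by (auto intro: Nor_tscale simp: tscale_add_right tscale_tscale mult.commute)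

lemma endomorphism_zero:
  assumes "endomorphism (Nor t) E" "t \<in> I"
  shows "E 0 = 0"
  using endomorphismD(3)[OF assms(1) Nor_zero[OF assms(2)], of 0] by (simp add: tscale_zero_left)

lemma endomorphism_diff:
  assumes E: "endomorphism (Nor t) E" and "t \<in> I" "u \<in> Nor t" "w \<in> Nor t"
  shows "E (u - w) = E u - E w"
proof -
  have "E (u + tscale (- 1) w) = E u + tscale (- 1) (E w)"
    using endomorphismD(2,3)[OF E] Nor_tscale assms by simp
  then show ?thesis by (simp add: tscale_minus_one)
qed

lemma endomorphism_inv_into:
  assumes E: "endomorphism (Nor t) E" "bij_betw E (Nor t) (Nor t)" and t: "t \<in> I"
  shows "endomorphism (Nor t) (inv_into (Nor t) E)"
proof -
  let ?i = "inv_into (Nor t) E"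
  have i: "?i w \<in> Nor t" "E (?i w) = w" if "w \<in> Nor t" for w
    using that E(2) by (auto simp: bij_betw_def inv_into_into f_inv_into_f)
  have uniq: "?i w = u" if "u \<in> Nor t" "E u = w" for u w
    using that E(2) by (auto simp: bij_betw_def)
  show ?thesis unfolding endomorphism_def
  proof (intro conjI ballI allI)
    fix u w assume uw: "u \<in> Nor t" "w \<in> Nor t"
    show "?i (u + w) = ?i u + ?i w"
      using i uw by (intro uniq Nor_add t) (simp_all add: endomorphismD(2)[OF E(1)])
  next
    fix a w assume w: "w \<in> Nor t"
    show "?i (tscale a w) = tscale a (?i w)"
      using i w by (intro uniq Nor_tscale t) (simp_all add: endomorphismD(3)[OF E(1)])
  qed (use i in blast)
qed

lemma has_deriv_ident:
  assumes "t \<in> I"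
  shows "has_deriv (\<lambda>s w. w) (\<lambda>w. 0) t"
proof (rule has_derivI)
  show "endomorphism (Nor t) (\<lambda>w. 0)"
    using Nor_zero[OF assms] unfolding endomorphism_def by (simp add: tscale_def fun_eq_iff)
qed (use smooth_normal_field_differentiable in auto)

lemma has_deriv_add:
  assumes E: "has_deriv E E' t" and F: "has_deriv F F' t" and t: "t \<in> I"
  shows "has_deriv (\<lambda>s w. E s w + F s w) (\<lambda>w. E' w + F' w) t"
proof (rule has_derivI)
  show "endomorphism (Nor t) (\<lambda>w. E' w + F' w)"
    by (intro endomorphism_add has_derivD(1)[OF E] has_derivD(1)[OF F] t)
  fix S P c assume P: "nearby S" "t \<in> S" "smooth_normal_field A L \<eta> I S P" and c: "c \<in> A" "t \<in> dom c"
  note d = has_derivD(2)[OF E P c] has_derivD(2)[OF F P c]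
  show "(\<lambda>s. (E s (P s) + F s (P s)) c) differentiable (at t within I) \<and>
      E' (P t) + F' (P t) = cov c (\<lambda>s. E s (P s) + F s (P s)) t - (E t (cov c P t) + F t (cov c P t))"
    using d has_derivD(3)[OF E P c] has_derivD(3)[OF F P c] differentiable_add[OF d]
      cov_add[OF c, of "\<lambda>s. E s (P s)" "\<lambda>s. F s (P s)"]
    by (simp add: plus_fun_apply)
qed

lemma has_deriv_tscale:
  assumes E: "has_deriv E E' t" and Et: "endomorphism (Nor t) (E t)" and t: "t \<in> I"
    and h: "(h has_vector_derivative h') (at t within I)"
  shows "has_deriv (\<lambda>s w. tscale (h s) (E s w)) (\<lambda>w. tscale (h t) (E' w) + tscale h' (E t w)) t"
proof (rule has_derivI)
  show "endomorphism (Nor t) (\<lambda>w. tscale (h t) (E' w) + tscale h' (E t w))"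
    by (intro endomorphism_add endomorphism_tscale has_derivD(1)[OF E] Et t)
  fix S P c assume P: "nearby S" "t \<in> S" "smooth_normal_field A L \<eta> I S P" and c: "c \<in> A" "t \<in> dom c"
  have d: "(\<lambda>s. E s (P s) c) differentiable (at t within I)" using has_derivD(2)[OF E P c] .
  have "E t (P t) \<in> tangent_space A (\<eta> t)"
    using endomorphismD(1)[OF Et] smooth_normal_fieldD(1)[OF P(3,2)] normal_complement_tangent by blast
  from cov_tscale[OF c, of "\<lambda>s. E s (P s)", OF d this h] has_derivD(3)[OF E P c]
  have "tscale (h t) (E' (P t)) + tscale h' (E t (P t)) =
      cov c (\<lambda>s. tscale (h s) (E s (P s))) t - tscale (h t) (E t (cov c P t))"
    by (simp add: tscale_def fun_eq_iff scaleR_diff_right)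
  moreover have "(\<lambda>s. tscale (h s) (E s (P s)) c) differentiable (at t within I)"
    unfolding tscale_apply
    using bounded_bilinear.has_vector_derivative[OF bounded_bilinear_scaleR h d[unfolded vector_derivative_works]]
    by (rule differentiableI_vector)
  ultimately show "(\<lambda>s. tscale (h s) (E s (P s)) c) differentiable (at t within I) \<and>
      tscale (h t) (E' (P t)) + tscale h' (E t (P t)) =
      cov c (\<lambda>s. tscale (h s) (E s (P s))) t - tscale (h t) (E t (cov c P t))" by blast
qed

text \<open>To invert an endomorphism field \<open>J\<close> of the normal spaces smoothly, it is extended to the
  coordinate space by the identity on the velocity; then Cramer's rule applies.\<close>

definition extend :: "('m, 'i) chart \<Rightarrow> (real \<Rightarrow> ('m, 'i) tvec \<Rightarrow> ('m, 'i) tvec) \<Rightarrow> real \<Rightarrow> real ^ 'i \<Rightarrow> real ^ 'i" where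
  "extend c J s w = J s (tvec_of A c (\<eta> s) (proj c s w)) c + (w - proj c s w)"

lemma linear_extend:
  assumes "c \<in> A" "s \<in> dom c" "endomorphism (Nor s) (J s)"
  shows "linear (extend c J s)"
proof -
  have n: "tvec_of A c (\<eta> s) (proj c s w) \<in> Nor s" for w
    using assms by (intro tvec_of_normal g_vel_proj) auto
  have e: "\<eta> s \<in> fst c" using assms(2) by simp
  show ?thesis
    by (intro linearI)
      (simp_all add: extend_def linear_add[OF linear_proj] linear_cmul[OF linear_proj] tvec_of_add[OF assms(1) e]
        tvec_of_scale[OF assms(1) e] endomorphismD(2,3)[OF assms(3)] n tscale_apply algebra_simps)
qed

lemma extend_normal:
  assumes "c \<in> A" "s \<in> dom c" "w \<in> Nor s"
  shows "extend c J s (w c) = J s w c"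
  using assms by (simp add: extend_def proj_normal tvec_of_tangent normal_complement_tangent)

text \<open>The extended map is block diagonal, with \<open>J\<close> on the normal space and the
  identity on the velocity. It preserves the component along the velocity, so a normal value can
  come only from a normal argument.\<close>

lemma extend_normal_value:
  assumes c: "c \<in> A" "s \<in> dom c" and J: "endomorphism (Nor s) (J s)" and g0: "g c s (vel s c) (extend c J s w) = 0"
  shows "tvec_of A c (\<eta> s) w \<in> Nor s" "extend c J s w = J s (tvec_of A c (\<eta> s) w) c"
proof -
  have "J s (tvec_of A c (\<eta> s) (proj c s w)) \<in> Nor s"
    by (intro endomorphismD(1)[OF J] tvec_of_normal g_vel_proj c)
  then have "g c s (vel s c) (extend c J s w) = g c s (vel s c) (w - proj c s w)"
    using normal_complement_iff[OF c] by (simp add: extend_def met_form_add_right)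
  also have "w - proj c s w = (- g c s (vel s c) w) *\<^sub>R vel s c" by (simp add: proj_def)
  also have "g c s (vel s c) \<dots> = g c s (vel s c) w" unfolding met_form_scale_right using g_vel_vel[OF c] by simp
  finally have g: "g c s (vel s c) w = 0" using g0 by simp
  then show "tvec_of A c (\<eta> s) w \<in> Nor s" by (rule tvec_of_normal[OF c])
  have "proj c s w = w" using g by (simp add: proj_def)
  then show "extend c J s w = J s (tvec_of A c (\<eta> s) w) c" by (simp add: extend_def)
qed

lemma smooth_extend:
  assumes c: "c \<in> A" and J: "smooth_endomorphism_field A L \<eta> I J"
  shows "smooth_curve_on (dom c) (\<lambda>s. extend c J s u)"
proof -
  have "smooth_normal_field A L \<eta> I (dom c) (\<lambda>s. J s (tvec_of A c (\<eta> s) (proj c s u)))"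
    using J smooth_normal_field_proj[OF c] open_dom[OF c] unfolding smooth_endomorphism_field_def by blast
  from smooth_normal_fieldD(2)[OF this c]
  have 1: "smooth_curve_on (dom c) (\<lambda>s. J s (tvec_of A c (\<eta> s) (proj c s u)) c)"
    by (rule smooth_curve_on_subset) auto
  show ?thesis unfolding extend_def
    by (intro smooth_curve_on_add smooth_curve_on_diff smooth_curve_on_const 1 smooth_proj c)
qed

text \<open>The determinant of the extended coordinate matrix is continuous, so invertibility at
  \<open>t\<close> spreads to a relative neighbourhood, where Cramer's rule writes the inverse
  through quotients of determinants with smooth entries.\<close>

lemma smooth_inverse_field:
  assumes J: "smooth_endomorphism_field A L \<eta> I J" and t: "t \<in> I" and bij: "bij_betw (J t) (Nor t) (Nor t)"
  obtains S0 where "nearby S0" "t \<in> S0" "\<And>s. s \<in> S0 \<Longrightarrow> bij_betw (J s) (Nor s) (Nor s)"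
    "\<And>S P. nearby S \<Longrightarrow> S \<subseteq> S0 \<Longrightarrow> smooth_normal_field A L \<eta> I S P \<Longrightarrow>
      smooth_normal_field A L \<eta> I S (\<lambda>s. inv_into (Nor s) (J s) (P s))"
proof -
  obtain c where c: "c \<in> A" "t \<in> dom c" using ex_dom t by blast
  have endo: "endomorphism (Nor s) (J s)" if "s \<in> dom c" for s
    using J that unfolding smooth_endomorphism_field_def by blast
  define M where "M s = matrix (extend c J s)" for s
  have M: "M s *v w = extend c J s w" if "s \<in> dom c" for s w
    unfolding M_def using linear_extend[of c s J] c that endo[OF that] by simp
  have M_smooth: "smooth_curve_on (dom c) (\<lambda>s. M s $ i $ j)" for i j
    unfolding M_def matrix_def
    using smooth_curve_on_component[OF smooth_extend[OF c(1) J]] by simp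
  define S0 where "S0 = {s \<in> dom c. det (M s) \<noteq> 0}"
  have S0_sub: "S0 \<subseteq> dom c" by (auto simp: S0_def)
  have "openin (top_of_set (dom c)) (dom c \<inter> (\<lambda>s. det (M s)) -` (- {0}))"
    using smooth_curve_on_imp_continuous_on[OF smooth_curve_on_det[OF M_smooth]]
    by (rule continuous_openin_preimage_gen) (simp add: open_Compl)
  then have near: "nearby S0"
    using openin_trans[OF _ open_dom[OF c(1)]] by (simp add: S0_def Int_def vimage_def)
  have ker: "J s w = 0 \<longrightarrow> w = 0" if "s \<in> S0" "w \<in> Nor s" for s w
  proof
    assume "J s w = 0"
    then have "M s *v (w c) = 0" using that S0_sub c by (simp add: M extend_normal subset_iff)
    moreover have "det (M s) \<noteq> 0" using that by (simp add: S0_def)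
    ultimately have "w c = 0" using cramer[of "M s" "w c" 0] cramer[of "M s" 0 0] by auto
    then show "w = 0" using that S0_sub c
      by (intro tangent_space_eqI[of w "\<eta> s" 0 c] normal_complement_tangent Nor_zero) auto
  qed
  have inj: "inj_on (J s) (Nor s)" if "s \<in> S0" for s
  proof (rule inj_onI)
    fix u w assume uw: "u \<in> Nor s" "w \<in> Nor s" "J s u = J s w"
    have s: "s \<in> dom c" "s \<in> I" using that S0_sub by auto
    from endomorphism_diff[OF endo[OF s(1)] s(2) uw(1,2)] uw(3) have "J s (u - w) = 0" by simp
    then have "u - w = 0" using ker[OF that Nor_diff[OF s(2) uw(1,2)]] by blast
    then show "u = w" by simp
  qed
  \<comment> \<open>Cramer's formula solves the extended system; by
    \<open>extend_normal_value\<close> the solution is normal and therefore solves the equation for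
    \<open>J\<close> itself. The explicit formula is kept in the statement because smoothness is
    later read off from it.\<close>
  have surj: "\<exists>u\<in>Nor s. J s u = y \<and> u c = (\<chi> k. det (\<chi> i j. if j = k then y c $ i else M s $ i $ j) / det (M s))"
    if "s \<in> S0" "y \<in> Nor s" for s y
  proof -
    have s: "s \<in> dom c" "\<eta> s \<in> fst c" "det (M s) \<noteq> 0" using that S0_sub by (auto simp: S0_def)
    let ?w = "\<chi> k. det (\<chi> i j. if j = k then y c $ i else M s $ i $ j) / det (M s)"
    have w: "extend c J s ?w = y c" using cramer[OF s(3), of ?w "y c"] M[OF s(1)] by simp
    have "g c s (vel s c) (extend c J s ?w) = 0"
      unfolding w using that(2) normal_complement_iff[OF c(1) s(1)] by blast
    note n = extend_normal_value[of c s J, OF c(1) s(1) endo[OF s(1)] this]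
    have "J s (tvec_of A c (\<eta> s) ?w) = y"
      using n w that c s endomorphismD(1)[OF endo[OF s(1)] n(1)]
      by (intro tangent_space_eqI[of _ "\<eta> s" _ c] normal_complement_tangent) simp_all
    then show ?thesis using n(1) tvec_of_apply_same[OF c(1) s(2)] by blast
  qed
  have bij': "bij_betw (J s) (Nor s) (Nor s)" if "s \<in> S0" for s
    unfolding bij_betw_def using inj[OF that] surj[OF that] endomorphismD(1)[OF endo] that S0_sub by blast
  \<comment> \<open>A vector killed by the extended map has the normal value 0, so it is normal
    itself, and injectivity of \<open>J t\<close> makes it vanish.\<close>
  have "t \<in> S0"
  proof -
    have "w = 0" if "M t *v w = 0" for w
    proof -
      have e: "extend c J t w = 0" using that M c by simp
      have "g c t (vel t c) (extend c J t w) = 0" unfolding e met_form_zero_right ..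
      note n = extend_normal_value[of c t J, OF c endo[OF c(2)] this, unfolded e]
      have "J t (tvec_of A c (\<eta> t) w) = 0"
        using n c t endomorphismD(1)[OF endo[OF c(2)] n(1)]
        by (intro tangent_space_eqI[of _ "\<eta> t" _ c] normal_complement_tangent Nor_zero) simp_all
      also have "0 = J t 0" using endomorphism_zero[OF endo[OF c(2)] t] by simp
      finally have "tvec_of A c (\<eta> t) w = 0"
        using bij n(1) Nor_zero[OF t] by (meson bij_betw_def inj_onD)
      then have "tvec_of A c (\<eta> t) w c = 0" by simp
      then show ?thesis using c by (simp add: tvec_of_apply_same)
    qed
    then have "inj ((*v) (M t))" by (simp add: linear_injective_0)
    then have "det (M t) \<noteq> 0"
      using matrix_left_invertible_injective[of "M t"] invertible_left_inverse[of "M t"] invertible_det_nz by blast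
    then show ?thesis using c by (simp add: S0_def)
  qed
  moreover have "smooth_normal_field A L \<eta> I S (\<lambda>s. inv_into (Nor s) (J s) (P s))"
    if S: "nearby S" "S \<subseteq> S0" "smooth_normal_field A L \<eta> I S P" for S P
  proof (rule smooth_normal_fieldI[OF c(1)])
    show Sd: "S \<subseteq> dom c" using S S0_sub by blast
    have P: "P s \<in> Nor s" if "s \<in> S" for s using smooth_normal_fieldD(1)[OF S(3) that] .
    show "inv_into (Nor s) (J s) (P s) \<in> Nor s" if "s \<in> S" for s
      using bij'[of s] P[OF that] that S(2) by (auto simp: bij_betw_def inv_into_into)
    have P_smooth: "smooth_curve_on S (\<lambda>s. P s c $ i)" for i
      by (rule smooth_curve_on_component, rule smooth_curve_on_subset[OF smooth_normal_fieldD(2)[OF S(3) c(1)]])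
        (use Sd in auto)
    have "smooth_curve_on S (\<lambda>s. \<chi> k. det (\<chi> i j. if j = k then P s c $ i else M s $ i $ j) / det (M s))"
    proof (intro smooth_curve_on_vec smooth_curve_on_divide smooth_curve_on_det)
      show "smooth_curve_on S (\<lambda>s. M s $ i $ j)" for i j using M_smooth Sd by (rule smooth_curve_on_subset)
      then show "smooth_curve_on S (\<lambda>s. (\<chi> i j. if j = k then P s c $ i else M s $ i $ j) $ i $ j)" for i j k
        using P_smooth by (cases "j = k") simp_all
    qed (use S(2) S0_def in auto)
    then show "smooth_curve_on S (\<lambda>s. inv_into (Nor s) (J s) (P s) c)"
    proof (rule smooth_curve_on_cong)
      fix s assume s: "s \<in> S"
      with S(2) have s0: "s \<in> S0" by blast
      obtain u where u: "u \<in> Nor s" "J s u = P s"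
        "u c = (\<chi> k. det (\<chi> i j. if j = k then P s c $ i else M s $ i $ j) / det (M s))"
        using surj[OF s0 P[OF s]] by blast
      then show "inv_into (Nor s) (J s) (P s) c = (\<chi> k. det (\<chi> i j. if j = k then P s c $ i else M s $ i $ j) / det (M s))"
        using inv_into_f_f[OF inj[OF s0] u(1)] by simp
    qed
  qed
  ultimately show thesis using that near bij' by blast
qed

text \<open>For a test field P put Q = J^-1 P. Differentiating J Q = P gives J DQ = DP - J' Q, and J
  may be cancelled because DQ is normal; inserting DQ into (K Q)' = K' Q + K DQ yields the formula.
  The choice K = J' is the one that produces J'' J^-1 - U^2.\<close>

lemma has_deriv_compose_inverse:
  assumes J: "smooth_endomorphism_field A L \<eta> I J" "has_deriv J J' t" and K: "has_deriv K K' t" "endomorphism (Nor t) (K t)"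
    and t: "t \<in> I" and bij: "bij_betw (J t) (Nor t) (Nor t)"
  defines "i \<equiv> inv_into (Nor t) (J t)"
  shows "has_deriv (\<lambda>s w. K s (inv_into (Nor s) (J s) w)) (\<lambda>w. K' (i w) + tscale (- 1) (K t (i (J' (i w))))) t"
proof (rule has_derivI)
  have Jt: "endomorphism (Nor t) (J t)" using J(1) t unfolding smooth_endomorphism_field_def by blast
  have i_endo: "endomorphism (Nor t) i" unfolding i_def by (rule endomorphism_inv_into[OF Jt bij t])
  have i_J: "i (J t w) = w" if "w \<in> Nor t" for w
    using bij that unfolding i_def bij_betw_def by simp
  show "endomorphism (Nor t) (\<lambda>w. K' (i w) + tscale (- 1) (K t (i (J' (i w)))))"
    by (intro endomorphism_add endomorphism_tscale t endomorphism_compose[OF has_derivD(1)[OF K(1)] i_endo]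
        endomorphism_compose[OF K(2)] endomorphism_compose[OF i_endo]
        endomorphism_compose[OF has_derivD(1)[OF J(2)]] i_endo)
  fix S P c assume P: "nearby S" "t \<in> S" "smooth_normal_field A L \<eta> I S P" and c: "c \<in> A" "t \<in> dom c"
  obtain S0 where S0: "nearby S0" "t \<in> S0" "\<And>s. s \<in> S0 \<Longrightarrow> bij_betw (J s) (Nor s) (Nor s)"
    "\<And>S P. nearby S \<Longrightarrow> S \<subseteq> S0 \<Longrightarrow> smooth_normal_field A L \<eta> I S P \<Longrightarrow>
      smooth_normal_field A L \<eta> I S (\<lambda>s. inv_into (Nor s) (J s) (P s))"
    using smooth_inverse_field[OF J(1) t bij] by blast
  define Q where "Q s = inv_into (Nor s) (J s) (P s)" for s
  have S1: "nearby (S0 \<inter> S)" "t \<in> S0 \<inter> S" using S0 P by (auto intro: openin_Int)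
  have Q: "smooth_normal_field A L \<eta> I (S0 \<inter> S) Q"
    unfolding Q_def using smooth_normal_field_subset[OF P(3), of "S0 \<inter> S"] S1 by (intro S0(4)) auto
  have JQ: "J s (Q s) = P s" if "s \<in> S0 \<inter> S" for s
    using that S0(3)[of s] smooth_normal_fieldD(1)[OF P(3), of s]
    unfolding Q_def bij_betw_def by (simp add: f_inv_into_f)
  have Qt: "Q t = i (P t)" by (simp add: Q_def i_def)
  note covQ = cov_smooth_normal_field[OF S1 Q c] and covP = cov_smooth_normal_field[OF P c]
  have "cov c (\<lambda>s. J s (Q s)) t = cov c P t"
    using cov_cong[OF smooth_normal_field_differentiable[OF P(3,1,2) c(1)] S1 JQ] c(2) by simp
  with has_derivD(3)[OF J(2) S1 Q c] have "J t (cov c Q t) = cov c P t - J' (Q t)"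
    by (simp add: algebra_simps)
  then have "cov c Q t = i (cov c P t - J' (Q t))" using i_J[OF covQ] by simp
  also have "\<dots> = i (cov c P t) - i (J' (Q t))"
    using endomorphismD(1)[OF has_derivD(1)[OF J(2)]] smooth_normal_fieldD(1)[OF Q S1(2)]
    by (intro endomorphism_diff[OF i_endo t covP])
  finally have "K t (cov c Q t) = K t (i (cov c P t)) - K t (i (J' (Q t)))"
    using endomorphism_diff[OF K(2) t] endomorphismD(1)[OF i_endo] covP
      endomorphismD(1)[OF has_derivD(1)[OF J(2)]] smooth_normal_fieldD(1)[OF Q S1(2)] by simp
  then show "(\<lambda>s. K s (inv_into (Nor s) (J s) (P s)) c) differentiable (at t within I) \<and>
      K' (i (P t)) + tscale (- 1) (K t (i (J' (i (P t))))) =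
      cov c (\<lambda>s. K s (inv_into (Nor s) (J s) (P s))) t - K t (inv_into (Nor t) (J t) (cov c P t))"
    using has_derivD(2,3)[OF K(1) S1 Q c] unfolding Q_def[symmetric] Qt i_def[symmetric]
    by (simp add: tscale_minus_one)
qed

end

section \<open>The Riccati equation\<close>

context timelike_geodesic
begin

text \<open>The weight is smooth only as a local restriction of smooth functions, its domain not
  being assumed open. Near each time one such extension \<open>h\<close>, composed with the lift of
  the geodesic, represents the weight along the curve.\<close>

lemma weight_along_locally_smooth:
  assumes \<psi>: "weight_function A L X \<psi>" and t: "t \<in> I"
  obtains S where "nearby S" "t \<in> S" "smooth_curve_on S (weight_along A \<psi> \<eta> I)"
proof -
  obtain c where c: "c \<in> A" "t \<in> dom c" using ex_dom t by blast
  let ?D = "{(p, w). p \<in> snd c ` fst c \<and>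
    tvec_of A c (chart_inv c p) w \<in> closure (future_timelike A L X (chart_inv c p)) - {0}}"
  have D: "lift c s \<in> ?D" if "s \<in> dom c" for s
  proof -
    have "vel s \<noteq> 0" using lift_in_slit[OF c(1) that] by auto
    moreover have "vel s \<in> closure (future_timelike A L X (\<eta> s))"
      using vel_future that closure_subset by blast
    ultimately show ?thesis
      using that c(1) by (simp add: chart_inv_left tvec_of_tangent vel_tangent)
  qed
  obtain W h where W: "open W" "lift c t \<in> W" "smooth_on W h" "\<And>y. y \<in> W \<inter> ?D \<Longrightarrow> h y = in_chart A c \<psi> y"
    using \<psi> c(1) D[OF c(2)] unfolding weight_function_def smooth_on_arbitrary_def by meson
  let ?S = "dom c \<inter> lift c -` W"
  have "openin (top_of_set (dom c)) ?S"
    by (rule continuous_openin_preimage_gen[OF smooth_curve_on_imp_continuous_on[OF smooth_lift[OF c(1)]] W(1)])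
  then have "nearby ?S" using open_dom[OF c(1)] by (rule openin_trans)
  moreover have "smooth_curve_on ?S (\<lambda>s. h (lift c s))"
    by (rule smooth_curve_on_compose[OF W(3) smooth_curve_on_subset[OF smooth_lift[OF c(1)]]]) auto
  then have "smooth_curve_on ?S (weight_along A \<psi> \<eta> I)"
  proof (rule smooth_curve_on_cong)
    fix s assume s: "s \<in> ?S"
    then have "h (lift c s) = in_chart A c \<psi> (lift c s)" using D by (intro W(4)) blast
    then show "weight_along A \<psi> \<eta> I s = h (lift c s)"
      using s c(1) by (simp add: in_chart_def weight_along_def chart_inv_left tvec_of_tangent vel_tangent)
  qed
  ultimately show thesis using that c(2) W(2) by blast
qed

lemma has_deriv_weighted_jacobi:
  assumes J: "has_deriv J J' s" "endomorphism (Nor s) (J s)" and s: "s \<in> I"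
    and f: "(f has_vector_derivative f') (at s within I)"
  shows "has_deriv (weighted_jacobi n f J)
    (\<lambda>w. tscale (exp (- f s / n)) (J' w + tscale (- f' / n) (J s w))) s"
proof -
  have "((\<lambda>r. exp (- f r / n)) has_vector_derivative exp (- f s / n) * (- f' / n)) (at s within I)"
    using f unfolding has_real_derivative_iff_has_vector_derivative[symmetric]
    by (rule DERIV_chain'[OF DERIV_cdivide[OF DERIV_minus] DERIV_exp])
  from has_deriv_tscale[OF J s this] show ?thesis
    unfolding weighted_jacobi_def[abs_def] by (simp add: tscale_add_right tscale_tscale)
qed

text \<open>The weight factors of \<open>J\<^sub>\<psi>\<close> and of its inverse cancel, except for the derivative of the weight.\<close>

lemma B_endo_eq:
  assumes J: "has_deriv J J' s" "endomorphism (Nor s) (J s)" and s: "s \<in> I"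
    and f: "(f has_vector_derivative f') (at s within I)"
    and bij: "bij_betw (J s) (Nor s) (Nor s)" and w: "w \<in> Nor s"
  shows "B_endo A L \<eta> I n \<epsilon> f J s w =
    tscale (exp (2 * (1 - \<epsilon>) / n * f s)) (J' (inv_into (Nor s) (J s) w) + tscale (- f' / n) w)"
proof -
  let ?e = "exp (f s / n)"
  have e: "exp (- f s / n) * ?e = 1" by (simp flip: exp_add)
  define u where "u = inv_into (Nor s) (J s) w"
  have u: "u \<in> Nor s" "J s u = w" using bij w unfolding u_def by (auto simp: bij_betw_def inv_into_into f_inv_into_f)
  have "inj_on (weighted_jacobi n f J s) (Nor s)"
  proof (rule inj_onI)
    fix x y assume xy: "x \<in> Nor s" "y \<in> Nor s" "weighted_jacobi n f J s x = weighted_jacobi n f J s y"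
    then have "tscale ?e (weighted_jacobi n f J s x) = tscale ?e (weighted_jacobi n f J s y)" by simp
    then have "J s x = J s y"
      unfolding weighted_jacobi_def tscale_tscale using e by (simp add: mult.commute tscale_one)
    then show "x = y" using xy bij by (meson bij_betw_def inj_onD)
  qed
  moreover have eu: "tscale ?e u \<in> Nor s" using u s by (intro Nor_tscale)
  moreover have "weighted_jacobi n f J s (tscale ?e u) = w"
    using u e by (simp add: weighted_jacobi_def endomorphismD(3)[OF J(2)] tscale_tscale tscale_one)
  ultimately have inv: "inv_into (Nor s) (weighted_jacobi n f J s) w = tscale ?e u"
    using inv_into_f_f by metis
  have "endo_deriv A L \<eta> I (weighted_jacobi n f J) s (tscale ?e u) = J' u + tscale (- f' / n) w"
  proof -
    have "J' (tscale ?e u) + tscale (- f' / n) (J s (tscale ?e u)) = tscale ?e (J' u + tscale (- f' / n) w)"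
      using u by (simp add: endomorphismD(3)[OF J(2)] endomorphismD(3)[OF has_derivD(1)[OF J(1)]]
          tscale_tscale tscale_add_right mult.commute)
    then show ?thesis
      unfolding endo_deriv_eq[OF has_deriv_weighted_jacobi[OF J s f] s eu]
      using e by (simp only: tscale_tscale tscale_one)
  qed
  then show ?thesis by (simp add: B_endo_def star_endo_def inv u_def)
qed

lemma riccati_equation:
  fixes \<epsilon> :: real
  assumes n: "n \<ge> 1" and \<psi>: "weight_function A L X \<psi>"
    and jac: "jacobi_tensor_field A L \<eta> I J" and t: "t \<in> I" and bij: "bij_betw (J t) (Nor t) (Nor t)"
  defines "f \<equiv> weight_along A \<psi> \<eta> I"
  defines "B \<equiv> B_endo A L \<eta> I n \<epsilon> f J"
  shows "endo_differentiable A L \<eta> I (weighted_jacobi n f J) t" "endo_differentiable A L \<eta> I B t"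
    "c \<in> A \<Longrightarrow> t \<in> dom c \<Longrightarrow> w \<in> Nor t \<Longrightarrow>
      star_endo A L \<eta> I n \<epsilon> f B t w + tscale (2 * \<epsilon> / n * star_fun n \<epsilon> f I f t) (B t w) + B t (B t w)
       + weighted_curvature A L \<eta> I n 0 \<epsilon> f c t w = 0"
proof -
  define f' where "f' s = vector_derivative f (at s within I)" for s
  define f'' where "f'' = vector_derivative f' (at t within I)"
  have f: "(f has_vector_derivative f' s) (at s within I)" if s: "s \<in> I" for s
    using weight_along_locally_smooth[OF \<psi> s] smooth_curve_on_has_vector_derivative unfolding f_def f'_def by metis
  obtain S where S: "nearby S" "t \<in> S" "smooth_curve_on S f"
    using weight_along_locally_smooth[OF \<psi> t] unfolding f_def by blast
  have "smooth_curve_on S f'"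
    unfolding f'_def[abs_def] by (rule smooth_curve_on_vector_derivative[OF S(3,1) at_within_I])
  then have f'_deriv: "(f' has_vector_derivative f'') (at t within I)"
    unfolding f''_def using S(1,2) by (rule smooth_curve_on_has_vector_derivative)
  have J: "smooth_endomorphism_field A L \<eta> I J" using jac unfolding jacobi_tensor_field_def by blast
  then have J_endo: "endomorphism (Nor s) (J s)" if "s \<in> I" for s
    using that unfolding smooth_endomorphism_field_def by blast
  obtain J' J'' where jac': "\<forall>s\<in>I. has_deriv J (J' s) s \<and> has_deriv J' (J'' s) s \<and>
      (\<forall>c\<in>A. \<eta> s \<in> fst c \<longrightarrow> (\<forall>w\<in>Nor s. J'' s w + curvature A L \<eta> I c s (J s w) = 0)) \<and>
      {w \<in> Nor s. J s w = 0} \<inter> {w \<in> Nor s. J' s w = 0} = {0}"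
    using jac unfolding jacobi_tensor_field_def by (elim conjE exE)
  have J': "has_deriv J (J' s) s" if "s \<in> I" for s using jac' that by simp
  have J'': "has_deriv J' (J'' t) t" using jac' t by simp
  have jacobi: "J'' t w + curvature A L \<eta> I c t (J t w) = 0" if "c \<in> A" "t \<in> dom c" "w \<in> Nor t" for c w
    using jac' that by simp
  show "endo_differentiable A L \<eta> I (weighted_jacobi n f J) t"
    unfolding endo_differentiable_def using has_deriv_weighted_jacobi[OF J'[OF t] J_endo[OF t] t f[OF t]] by blast

  define i where "i = inv_into (Nor t) (J t)"
  define U where "U w = J' t (i w)" for w
  define \<mu> where "\<mu> s = exp (2 * (1 - \<epsilon>) / n * f s)" for s
  define \<mu>' where "\<mu>' = \<mu> t * (2 * (1 - \<epsilon>) / n * f' t)"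
  \<comment> \<open>The closed form of \<open>B\<close>, which \<open>B_endo_eq\<close> justifies
    only at times where \<open>J\<close> is bijective on the normal space.\<close>
  define B0 where "B0 s w = tscale (\<mu> s) (J' s (inv_into (Nor s) (J s) w) + tscale (- f' s / n) w)" for s w
  have J'_endo: "endomorphism (Nor t) (J' t)" using has_derivD(1)[OF J'[OF t]] .
  have i_endo: "endomorphism (Nor t) i"
    unfolding i_def by (rule endomorphism_inv_into[OF J_endo[OF t] bij t])
  have U_endo: "endomorphism (Nor t) U"
    unfolding U_def[abs_def] by (rule endomorphism_compose[OF J'_endo i_endo])
  have B0_t: "B0 t w = tscale (\<mu> t) (U w + tscale (- f' t / n) w)" for w
    by (simp add: B0_def U_def i_def)
  have B_eq: "B s w = B0 s w" if "s \<in> I" "bij_betw (J s) (Nor s) (Nor s)" "w \<in> Nor s" for s w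
    unfolding B_def B0_def \<mu>_def using B_endo_eq[OF J' J_endo _ f that(2,3)] that(1) by blast

  \<comment> \<open>The derivative of U - f' / n: the first bracket is the quotient rule with K =
    J', the second the product rule for a scalar multiple of the identity, whose own derivative is
    the zero map.\<close>
  let ?E' = "\<lambda>w. (J'' t (i w) + tscale (- 1) (J' t (i (J' t (i w))))) + (tscale (- f' t / n) 0 + tscale (- f'' / n) w)"
  have "has_deriv (\<lambda>s w. J' s (inv_into (Nor s) (J s) w)) (\<lambda>w. J'' t (i w) + tscale (- 1) (J' t (i (J' t (i w))))) t"
    unfolding i_def by (rule has_deriv_compose_inverse[OF J J'[OF t] J'' J'_endo t bij])
  moreover have "((\<lambda>s. - f' s / n) has_vector_derivative - f'' / n) (at t within I)"
    using f'_deriv unfolding has_real_derivative_iff_has_vector_derivative[symmetric]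
    by (intro DERIV_cdivide DERIV_minus)
  from has_deriv_tscale[OF has_deriv_ident[OF t] endomorphism_ident t this]
  have "has_deriv (\<lambda>s. tscale (- f' s / n)) (\<lambda>w. tscale (- f' t / n) 0 + tscale (- f'' / n) w) t" .
  ultimately have E: "has_deriv (\<lambda>s w. J' s (inv_into (Nor s) (J s) w) + tscale (- f' s / n) w) ?E' t"
    by (rule has_deriv_add[OF _ _ t])
  have Et: "endomorphism (Nor t) (\<lambda>w. J' t (inv_into (Nor t) (J t) w) + tscale (- f' t / n) w)"
    unfolding i_def[symmetric]
    by (intro endomorphism_add endomorphism_compose[OF J'_endo i_endo] endomorphism_tscale endomorphism_ident t)
  have "(\<mu> has_vector_derivative \<mu>') (at t within I)"
    using f[OF t] n unfolding has_real_derivative_iff_has_vector_derivative[symmetric] \<mu>_def[abs_def] \<mu>'_def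
    by (auto intro!: derivative_eq_intros)
  from has_deriv_tscale[OF E Et t this]
  have B0: "has_deriv B0 (\<lambda>w. tscale (\<mu> t) (?E' w) + tscale \<mu>' (U w + tscale (- f' t / n) w)) t"
    unfolding B0_def[abs_def] U_def i_def .
  obtain S0 where S0: "nearby S0" "t \<in> S0" "\<And>s. s \<in> S0 \<Longrightarrow> bij_betw (J s) (Nor s) (Nor s)"
    using smooth_inverse_field[OF J t bij] by metis
  \<comment> \<open>Invertibility of \<open>J\<close> persists on \<open>S0\<close>, so
    \<open>B\<close> and \<open>B0\<close> agree there and the derivative carries over.\<close>
  have B': "has_deriv B (\<lambda>w. tscale (\<mu> t) (?E' w) + tscale \<mu>' (U w + tscale (- f' t / n) w)) t"
    using S0 nearby_subset by (intro has_deriv_cong[OF B0 S0(1,2)] B_eq) auto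
  then show "endo_differentiable A L \<eta> I B t" unfolding endo_differentiable_def by blast

  assume c: "c \<in> A" "t \<in> dom c" and w: "w \<in> Nor t"
  have Uw: "U w \<in> Nor t" using endomorphismD(1)[OF U_endo w] .
  have Bw: "B t w = tscale (\<mu> t) (U w + tscale (- f' t / n) w)"
    using B_eq[OF t bij w] B0_t by simp
  have "B t w \<in> Nor t" unfolding Bw using Uw w t by (intro Nor_tscale Nor_add)
  then have "B t (B t w) = tscale (\<mu> t) (U (B t w) + tscale (- f' t / n) (B t w))"
    using B_eq[OF t bij] B0_t by simp
  also have "U (B t w) = tscale (\<mu> t) (U (U w) + tscale (- f' t / n) (U w))"
    unfolding Bw using Uw w t by (simp add: endomorphismD(2,3)[OF U_endo] Nor_tscale Nor_add)
  finally have BBw: "B t (B t w) = tscale (\<mu> t) (tscale (\<mu> t) (U (U w) + tscale (- f' t / n) (U w))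
      + tscale (- f' t / n) (tscale (\<mu> t) (U w + tscale (- f' t / n) w)))" unfolding Bw .
  \<comment> \<open>Evaluating the Jacobi equation at J^-1 w turns J'' J^-1 into -R.\<close>
  have "J t (i w) = w" using bij w unfolding i_def bij_betw_def by (simp add: f_inv_into_f)
  with jacobi[OF c endomorphismD(1)[OF i_endo w]] have R: "J'' t (i w) = - curvature A L \<eta> I c t w"
    by (simp add: eq_neg_iff_add_eq_0)
  have star: "star_endo A L \<eta> I n \<epsilon> f B t w = tscale (\<mu> t) (tscale (\<mu> t)
      ((- curvature A L \<eta> I c t w + tscale (- 1) (U (U w))) + (tscale (- f' t / n) 0 + tscale (- f'' / n) w))
      + tscale \<mu>' (U w + tscale (- f' t / n) w))"
    unfolding star_endo_def endo_deriv_eq[OF B' t w] R \<mu>_def[symmetric] by (simp add: U_def)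
  have curv: "weighted_curvature A L \<eta> I n 0 \<epsilon> f c t w = tscale (\<mu> t * \<mu> t)
      (curvature A L \<eta> I c t w + tscale (1 / n * (f'' - (f' t)\<^sup>2 / (0 - real n))) w)"
  proof -
    have "exp (4 * (1 - \<epsilon>) / n * f t) = \<mu> t * \<mu> t"
      unfolding \<mu>_def exp_add[symmetric] by (simp add: field_simps)
    then show ?thesis unfolding weighted_curvature_def Let_def f''_def f'_def[abs_def] by simp
  qed
  have sf: "star_fun n \<epsilon> f I f t = \<mu> t * f' t"
    by (simp add: star_fun_def \<mu>_def f'_def)
  \<comment> \<open>Here l, p, q stand for \<mu>, f', f'' at \<open>t\<close>, and r, a, b, x for
    one coordinate, in one chart, of R w, U w, U (U w) and w. The term \<open>0 - real n\<close> is
    N - n at N = 0.\<close>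
  have alg: "l * (l * ((- r + - 1 * b) + (- p / n * 0 + - q / n * x)) + l * (2 * (1 - \<epsilon>) / n * p) * (a + - p / n * x))
      + 2 * \<epsilon> / n * (l * p) * (l * (a + - p / n * x))
      + l * (l * (b + - p / n * a) + - p / n * (l * (a + - p / n * x)))
      + l * l * (r + 1 / n * (q - p\<^sup>2 / (0 - real n)) * x) = 0" for l r b p q x a :: real
    using n by (simp add: field_simps power2_eq_square)
  show "star_endo A L \<eta> I n \<epsilon> f B t w + tscale (2 * \<epsilon> / n * star_fun n \<epsilon> f I f t) (B t w) + B t (B t w)
       + weighted_curvature A L \<eta> I n 0 \<epsilon> f c t w = 0"
    unfolding star curv BBw unfolding sf Bw \<mu>'_def
    by (rule ext, simp only: vec_eq_iff, rule allI)
      (simp only: plus_fun_apply fun_Compl_def uminus_apply zero_fun_apply tscale_apply vector_add_component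
        vector_scaleR_component vector_uminus_component zero_index real_scaleR_def alg)
qed

end

theorem lemma5p5:
  fixes A :: "('m::{t2_space, second_countable_topology}, 'i::finite) chart set"
    and L \<psi> :: "'m \<Rightarrow> ('m, 'i) tvec \<Rightarrow> real"
    and X :: "'m \<Rightarrow> ('m, 'i) tvec"
    and n :: nat
    and \<eta> :: "real \<Rightarrow> 'm"
    and I :: "real set"
    and J :: "real \<Rightarrow> ('m, 'i) tvec \<Rightarrow> ('m, 'i) tvec"
    and \<epsilon> t :: real
  defines "\<psi>\<^sub>\<eta> \<equiv> weight_along A \<psi> \<eta> I"
    and "B \<equiv> B_endo A L \<eta> I n \<epsilon> (weight_along A \<psi> \<eta> I) J"
  assumes "CARD('i) = n + 1" and "n \<ge> 1"
    and "weighted_finsler_spacetime A L X \<psi>"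
    and "unit_timelike_geodesic A L X \<eta> I"
    and "jacobi_tensor_field A L \<eta> I J"
    and "t \<in> I"
    and "bij_betw (J t) (normal_complement A L \<eta> I t) (normal_complement A L \<eta> I t)"
  shows "endo_differentiable A L \<eta> I (weighted_jacobi n \<psi>\<^sub>\<eta> J) t \<and>
    endo_differentiable A L \<eta> I B t \<and>
    (\<forall>c\<in>A. \<eta> t \<in> fst c \<longrightarrow> (\<forall>w\<in>normal_complement A L \<eta> I t.
       star_endo A L \<eta> I n \<epsilon> \<psi>\<^sub>\<eta> B t w
       + tscale (2 * \<epsilon> / n * star_fun n \<epsilon> \<psi>\<^sub>\<eta> I \<psi>\<^sub>\<eta> t) (B t w)
       + B t (B t w)
       + weighted_curvature A L \<eta> I n 0 \<epsilon> \<psi>\<^sub>\<eta> c t w = 0))"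
proof -
  interpret timelike_geodesic A L X \<eta> I
    using assms(5,6) by unfold_locales (auto simp: weighted_finsler_spacetime_def finsler_spacetime_def)
  have "weight_function A L X \<psi>" using assms(5) by (simp add: weighted_finsler_spacetime_def)
  note riccati_equation[OF assms(4) this assms(7-9)]
  then show ?thesis unfolding \<psi>\<^sub>\<eta>_def B_def using assms(8) by blast
qed

end
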